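(* There is an absolute constant $c_1>0$ such that for every fixed $\epsilon$ with $0<\epsilon<\frac1{100}$, with high probability, for every integer $k$ with $k_1:=\sqrt{\frac{c_1 n}{\log n}}\le k<\epsilon^3 n$, \[|\mathcal L_k\setminus C_{\tau_{\mathrm{end}}}|\ge \frac{(1-\rho)\,e^{-\frac{10n}{9k}}}{2}\binom nk,\qquad\text{where }\ \rho=\max\left(1-\Big(\frac{k+1}{en}\Big)^{100},\ 1-\Big(\frac1{10e}\Big)^{10}\right).\]
   Context: Let $n\ge 1$ and $\mathcal B=\{0,1\}^n$ with the coordinatewise partial order; $\mathbf 0=(0,\dots,0)$, $\mathbf 1=(1,\dots,1)$, $|x|$ denotes the number of ones of $x$, and $\mathcal L_k=\{x\in\mathcal B:|x|=k\}$ is the $k$th level, so $|\mathcal L_k|=\binom nk$. A random decreasing walk from $\mathbf 1$ is a maximal chain $\mathbf 1=x_n>x_{n-1}>\dots>x_0=\mathbf 0$ with $x_i\in\mathcal L_i$, chosen uniformly among all $n!$ such chains (equivalently, each step turns a uniformly random remaining $1$ into $0$). The DLA process on $\mathcal B$: $C_0=\{\mathbf 0\}$; for $t\ge1$, let $\rho_t$ be a random decreasing walk from $\mathbf 1$, independent of everything before; let $v$ be the last vertex of the longest initial segment of $\rho_t$ that is disjoint from $C_{t-1}$, and set $C_t=C_{t-1}\cup\{v\}$. The process terminates at the first time $\tau_{\mathrm{end}}$ with $\mathbf 1\in C_{\tau_{\mathrm{end}}}$ (for $t>\tau_{\mathrm{end}}$ put $C_t=C_{\tau_{\mathrm{end}}}$).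 A vertex is occupied at time $t$ if it lies in $C_t$. "With high probability" (w.h.p.) means with probability tending to $1$ as $n\to\infty$; $\log$ is the natural logarithm. *)

theory Defs
  imports "HOL-Analysis.Analysis" "HOL-Probability.Probability" "HOL-Combinatorics.Multiset_Permutations"
begin

text \<open>A vertex x of the cube {0,1}^n is represented by its set of coordinates equal to 1,
  a subset of {0..<n}. So the all-zero vertex is the empty set and the all-one vertex is {0..<n};
  the number of ones |x| is card x.\<close>

definition level :: "nat \<Rightarrow> nat \<Rightarrow> nat set set" where
  "level n k = {x. x \<subseteq> {0..<n} \<and> card x = k}"

text \<open>A random decreasing walk from the top is determined by the (uniformly random) order
  sigma in which the n ones are turned into zeros: its j-th vertex (j = 0..n) is the top
  with the first j coordinates of sigma removed; it lies on level n - j.\<close>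

definition walk_vertex :: "nat \<Rightarrow> nat list \<Rightarrow> nat \<Rightarrow> nat set" where
  "walk_vertex n \<sigma> j = {0..<n} - set (take j \<sigma>)"

text \<open>One DLA step: if the top is occupied the process has terminated and nothing changes.
  Otherwise, with h the first index at which the walk hits C, the initial segment of
  vertices 0..h-1 is the longest one disjoint from C, and its last vertex is added.\<close>

definition dla_step :: "nat \<Rightarrow> nat set set \<Rightarrow> nat set set pmf" where
  "dla_step n C =
     (if {0..<n} \<in> C then return_pmf C
      else map_pmf
        (\<lambda>\<sigma>. C \<union> {walk_vertex n \<sigma> ((LEAST j. walk_vertex n \<sigma> j \<in> C) - 1)})
        (pmf_of_set (permutations_of_set {0..<n})))"

primrec dla_state :: "nat \<Rightarrow> nat \<Rightarrow> nat set set pmf" where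
  "dla_state n 0 = return_pmf {{}}"
| "dla_state n (Suc t) = bind_pmf (dla_state n t) (dla_step n)"

text \<open>Every non-terminal step adds a new vertex, so tau_end \<le> 2^n - 1 deterministically and
  C_{tau_end} = C_{2^n}.\<close>

definition dla_final :: "nat \<Rightarrow> nat set set pmf" where
  "dla_final n = dla_state n (2 ^ n)"

end

theory Submission
  imports Defs "HOL-Real_Asymp.Real_Asymp"
begin

text \<open>
  Write $L_j$ for the levels and put $T_k = \binom{n}{k+1}/100$. For $k < 10^{-6} n$ two facts
  combine.

  Up to time $T_k$ a given $x \in L_k$ is hit with probability at most $1/|L_k|$ per step, so about
  $e^{-T_k/|L_k|}|L_k|$ vertices of $L_k$ are still vacant. On the other hand, by induction on $k$,
  with overwhelming probability every $y \in L_{k+1}$ has at least $19/20$ of its children occupied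
  at time $T_k$: before $T_k$ the cluster above $L_k$ is so sparse that most walks through a given
  $x \in L_k$ are not blocked, and such a walk stops at $x$ as soon as most children of $x$ are
  occupied.

  From then on, a walk that reaches $y \in L_{k+1}$ continues to a uniform child of $y$. It takes a
  given vacant child with probability $1/(k+1)$, but with probability at least $19/20$ it stops at
  $y$ and thus removes $y$ as an access to all vacant children. Giving a vacant $x$ the weight
  $(1 + \frac{20}{19(k+1)})^{-m}$, where $m$ is the number of vacant vertices of $L_{k+1}$ above
  $x$, the total weight is a submartingale. Its increments are bounded by 2 and it moves at most
  $|L_k| + |L_{k+1}|$ times, hence it stays above half of its value at time $T_k$, which is at
  least $e^{-10n/(9k)}|L_k|/2$. The fluctuations are negligible once
  $k \geq \sqrt{40 n/\log n}$, because then $\binom nk$ dominates $n^2 e^{20n/(9k)}$.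
\<close>

section \<open>Random walks through prescribed vertices\<close>

text \<open>The hitting rate 1/|L_k| of a vacant vertex cannot be summed over the whole process, for
  the only bound at hand on its length is 2^n. After T_k time is therefore measured by attachments
  on two adjacent levels: the exposure of \<open>x\<close>, its vacant parents, is used up together
  with the vacant vertices, so the estimate does not depend on the number of remaining steps.

  Constants: the phase before T_k costs at most the factor exp(-(1/50) n/k), the odds at saturated
  vertices cost exp(-(20/19) n/k), and 1/50 + 20/19 < 10/9. Each phase also loses a factor 2; the
  statement allows this because 1 - rho <= 1/2. The fraction 1/100 in T_k keeps the drift of the
  blockage at 4/100, below the tolerated 1/10, and then a vacant vertex with 19/20 of its children
  occupied is hit with probability at least (19/20 - 1/10)/|L_k|. In the induction for saturation,
  failure must be rare enough for a union bound over all \<open>y\<close> in L_{k+1} and all sets of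
  its children. For k < n/10^6 that number is exponential in n with a smaller rate than the failure
  probability.\<close>

lemma card_permutations_prefix:
  assumes "finite M" "A \<subseteq> M"
  shows "card {\<sigma> \<in> permutations_of_set M. set (take (card A) \<sigma>) = A \<and> P (drop (card A) \<sigma>)}
    = fact (card A) * card {\<tau> \<in> permutations_of_set (M - A). P \<tau>}"
proof -
  have fA: "finite A" using assms finite_subset by blast
  let ?R = "{\<sigma> \<in> permutations_of_set M. set (take (card A) \<sigma>) = A \<and> P (drop (card A) \<sigma>)}"
  let ?L = "permutations_of_set A \<times> {\<tau> \<in> permutations_of_set (M - A). P \<tau>}"
  have "bij_betw (\<lambda>(p, q). p @ q) ?L ?R"
  proof (rule bij_betw_byWitness[where f' = "\<lambda>\<sigma>. (take (card A) \<sigma>, drop (card A) \<sigma>)"])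
    show "\<forall>a\<in>?L. (\<lambda>\<sigma>. (take (card A) \<sigma>, drop (card A) \<sigma>)) ((\<lambda>(p, q). p @ q) a) = a"
      by (auto simp: length_finite_permutations_of_set)
    show "\<forall>\<sigma>\<in>?R. (\<lambda>(p, q). p @ q) (take (card A) \<sigma>, drop (card A) \<sigma>) = \<sigma>" by simp
    show "(\<lambda>(p, q). p @ q) ` ?L \<subseteq> ?R"
      using assms by (auto simp: length_finite_permutations_of_set permutations_of_set_def)
    show "(\<lambda>\<sigma>. (take (card A) \<sigma>, drop (card A) \<sigma>)) ` ?R \<subseteq> ?L"
    proof (clarsimp)
      fix \<sigma> assume s: "\<sigma> \<in> permutations_of_set M" "set (take (card A) \<sigma>) = A" "P (drop (card A) \<sigma>)"
      have d: "distinct \<sigma>" "set \<sigma> = M" using s(1) by (auto dest: permutations_of_setD)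
      have "set (take (card A) \<sigma>) \<inter> set (drop (card A) \<sigma>) = {}"
        using d(1) by (simp add: set_take_disj_set_drop_if_distinct)
      moreover have "set (take (card A) \<sigma>) \<union> set (drop (card A) \<sigma>) = M"
        using d(2) by (metis append_take_drop_id set_append)
      ultimately have "set (drop (card A) \<sigma>) = M - A" using s(2) by blast
      thus "take (card A) \<sigma> \<in> permutations_of_set A \<and> drop (card A) \<sigma> \<in> permutations_of_set (M - A)"
        using s(2) d(1) by (auto intro!: permutations_of_setI)
    qed
  qed
  hence "card ?R = card ?L" by (simp add: bij_betw_same_card)
  thus ?thesis using fA by (simp add: card_cartesian_product)
qed

text \<open>The one-prefix count is used twice: for \<open>A\<close> in \<open>M\<close>, with
  \<open>P\<close> saying that the next block is \<open>B - A\<close>, and then for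
  \<open>B - A\<close> in \<open>M - A\<close>. This is why \<open>P\<close> is carried along in
  \<open>card_permutations_prefix\<close>.\<close>

lemma card_permutations_two_prefixes:
  assumes "finite M" "A \<subseteq> B" "B \<subseteq> M"
  shows "card {\<sigma> \<in> permutations_of_set M. set (take (card A) \<sigma>) = A \<and> set (take (card B) \<sigma>) = B}
    = fact (card A) * (fact (card B - card A) * fact (card M - card B))"
proof -
  have fin: "finite A" "finite B" using finite_subset[of A M] finite_subset[of B M] assms by auto
  have c: "card A \<le> card B" using assms fin by (simp add: card_mono)
  have split: "set (take (card B) \<sigma>) = A \<union> set (take (card B - card A) (drop (card A) \<sigma>))"
    if "set (take (card A) \<sigma>) = A" for \<sigma> :: "'a list"
    using that c by (metis le_add_diff_inverse set_append take_add)
  have dj: "set (take (card B - card A) (drop (card A) \<sigma>)) \<inter> A = {}"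
    if "\<sigma> \<in> permutations_of_set M" "set (take (card A) \<sigma>) = A" for \<sigma>
  proof -
    have "distinct \<sigma>" using that by (auto dest: permutations_of_setD)
    hence "set (take (card A) \<sigma>) \<inter> set (drop (card A) \<sigma>) = {}"
      by (simp add: set_take_disj_set_drop_if_distinct)
    thus ?thesis
      using that(2) set_take_subset[of "card B - card A" "drop (card A) \<sigma>"] by blast
  qed
  have "{\<sigma> \<in> permutations_of_set M. set (take (card A) \<sigma>) = A \<and> set (take (card B) \<sigma>) = B}
     = {\<sigma> \<in> permutations_of_set M. set (take (card A) \<sigma>) = A \<and>
          set (take (card B - card A) (drop (card A) \<sigma>)) = B - A}"
  proof (intro Collect_cong conj_cong refl)
    fix \<sigma> assume "\<sigma> \<in> permutations_of_set M" "set (take (card A) \<sigma>) = A"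
    with split[of \<sigma>] dj[of \<sigma>] assms(2)
    show "set (take (card B) \<sigma>) = B \<longleftrightarrow> set (take (card B - card A) (drop (card A) \<sigma>)) = B - A"
      by auto
  qed
  also have "card \<dots> = fact (card A) * card {\<tau> \<in> permutations_of_set (M - A).
      set (take (card B - card A) \<tau>) = B - A}"
    using card_permutations_prefix[of M A "\<lambda>\<tau>. set (take (card B - card A) \<tau>) = B - A"] assms
    by auto
  also have "card {\<tau> \<in> permutations_of_set (M - A). set (take (card B - card A) \<tau>) = B - A}
      = fact (card B - card A) * fact (card M - card B)"
  proof -
    have cB: "card (B - A) = card B - card A" using fin assms(2) by (simp add: card_Diff_subset)
    have "M - A - (B - A) = M - B" using assms by blast
    moreover have "card (M - B) = card M - card B" using fin assms by (simp add: card_Diff_subset)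
    ultimately show ?thesis
      using card_permutations_prefix[of "M - A" "B - A" "\<lambda>_. True"] assms cB by (simp add: Diff_mono)
  qed
  finally show ?thesis .
qed

abbreviation walks :: "nat \<Rightarrow> nat list pmf" where
  "walks n \<equiv> pmf_of_set (permutations_of_set {0..<n})"

lemma set_pmf_walks [simp]: "set_pmf (walks n) = permutations_of_set {0..<n}"
  by (rule set_pmf_of_set) auto

lemma card_walk_vertex:
  assumes "\<sigma> \<in> permutations_of_set {0..<n}" "j \<le> n"
  shows "card (walk_vertex n \<sigma> j) = n - j"
proof -
  have "distinct \<sigma>" "set \<sigma> = {0..<n}" "length \<sigma> = n"
    using assms(1) by (auto dest: permutations_of_setD simp: length_finite_permutations_of_set)
  hence "card (set (take j \<sigma>)) = j" "set (take j \<sigma>) \<subseteq> {0..<n}"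
    using assms(2) set_take_subset[of j \<sigma>] by (auto simp: distinct_card)
  thus ?thesis unfolding walk_vertex_def by (simp add: card_Diff_subset)
qed

lemma walk_vertex_eq_iff:
  assumes "\<sigma> \<in> permutations_of_set {0..<n}" "v \<subseteq> {0..<n}"
  shows "walk_vertex n \<sigma> j = v \<longleftrightarrow> set (take j \<sigma>) = {0..<n} - v"
proof -
  have "set (take j \<sigma>) \<subseteq> {0..<n}"
    using assms(1) set_take_subset[of j \<sigma>] by (auto dest: permutations_of_setD)
  thus ?thesis using assms(2) unfolding walk_vertex_def by blast
qed

lemma walk_vertex_antimono: "i \<le> j \<Longrightarrow> walk_vertex n \<sigma> j \<subseteq> walk_vertex n \<sigma> i"
  unfolding walk_vertex_def using set_take_subset_set_take[of i j \<sigma>] by blast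

lemma walk_vertex_subset: "walk_vertex n \<sigma> j \<subseteq> {0..<n}"
  by (auto simp: walk_vertex_def)

lemma walk_vertex_Suc:
  assumes "\<sigma> \<in> permutations_of_set {0..<n}" "j < n"
  shows "walk_vertex n \<sigma> (Suc j) = walk_vertex n \<sigma> j - {\<sigma> ! j}" "\<sigma> ! j \<in> walk_vertex n \<sigma> j"
proof -
  have d: "distinct \<sigma>" "set \<sigma> = {0..<n}" "length \<sigma> = n"
    using assms(1) by (auto dest: permutations_of_setD simp: length_finite_permutations_of_set)
  have t: "take (Suc j) \<sigma> = take j \<sigma> @ [\<sigma> ! j]" using d assms by (simp add: take_Suc_conv_app_nth)
  show "walk_vertex n \<sigma> (Suc j) = walk_vertex n \<sigma> j - {\<sigma> ! j}"
    unfolding walk_vertex_def t by auto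
  have "distinct (take j \<sigma> @ [\<sigma> ! j])" using d(1) t by (metis distinct_take)
  thus "\<sigma> ! j \<in> walk_vertex n \<sigma> j"
    unfolding walk_vertex_def using d assms by auto
qed

lemma walk_vertex_0: "walk_vertex n \<sigma> 0 = {0..<n}"
  by (simp add: walk_vertex_def)

lemma walk_vertex_end: "\<sigma> \<in> permutations_of_set {0..<n} \<Longrightarrow> walk_vertex n \<sigma> n = {}"
  by (auto simp: walk_vertex_def length_finite_permutations_of_set dest: permutations_of_setD)

text \<open>The walk meets level |v| in a uniform vertex and, given \<open>v\<close>, meets level
  |x| in a uniform |x|-subset of \<open>v\<close>. Index j belongs to level n - j, hence the indices
  \<open>n - card v\<close> and \<open>n - card x\<close>.\<close>

lemma prob_walk_two_vertices:
  assumes "x \<subseteq> v" "v \<subseteq> {0..<n}"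
  shows "measure_pmf.prob (walks n)
      {\<sigma>. walk_vertex n \<sigma> (n - card v) = v \<and> walk_vertex n \<sigma> (n - card x) = x}
    = 1 / (real (n choose card v) * real (card v choose card x))"
proof -
  let ?A = "{0..<n} - v" and ?B = "{0..<n} - x"
  have fin: "finite v" "finite x" using assms by (meson finite_atLeastLessThan finite_subset)+
  have c: "card ?A = n - card v" "card ?B = n - card x" "card x \<le> card v" "card v \<le> n"
    using assms fin card_mono[OF _ assms(2)] by (auto simp: card_Diff_subset card_mono)
  have "permutations_of_set {0..<n} \<inter>
      {\<sigma>. walk_vertex n \<sigma> (n - card v) = v \<and> walk_vertex n \<sigma> (n - card x) = x}
    = {\<sigma> \<in> permutations_of_set {0..<n}. set (take (card ?A) \<sigma>) = ?A \<and> set (take (card ?B) \<sigma>) = ?B}"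
    unfolding c Int_def mem_Collect_eq using assms
    by (intro Collect_cong conj_cong refl walk_vertex_eq_iff) auto
  also have "card \<dots> = fact (card ?A) * (fact (card ?B - card ?A) * fact (card {0..<n} - card ?B))"
    by (rule card_permutations_two_prefixes) (use assms in auto)
  also have "\<dots> = fact (n - card v) * (fact (card v - card x) * fact (card x))"
    using c by simp
  finally have cd: "card (permutations_of_set {0..<n} \<inter>
      {\<sigma>. walk_vertex n \<sigma> (n - card v) = v \<and> walk_vertex n \<sigma> (n - card x) = x})
    = fact (n - card v) * (fact (card v - card x) * fact (card x))" .
  have b: "real (n choose card v) = fact n / (fact (card v) * fact (n - card v))"
    "real (card v choose card x) = fact (card v) / (fact (card x) * fact (card v - card x))"
    using c by (auto simp: binomial_fact)
  show ?thesis
    by (subst measure_pmf_of_set) (auto simp: cd b)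
qed

lemma prob_walk_vertex:
  assumes "v \<subseteq> {0..<n}"
  shows "measure_pmf.prob (walks n) {\<sigma>. walk_vertex n \<sigma> (n - card v) = v} = 1 / real (n choose card v)"
  using prob_walk_two_vertices[of v v n] assms by simp

section \<open>The attachment site\<close>

definition dla_site :: "nat \<Rightarrow> nat set set \<Rightarrow> nat list \<Rightarrow> nat set" where
  "dla_site n C \<sigma> = walk_vertex n \<sigma> ((LEAST j. walk_vertex n \<sigma> j \<in> C) - 1)"

definition site_pmf :: "nat \<Rightarrow> nat set set \<Rightarrow> nat set pmf" where
  "site_pmf n C = map_pmf (dla_site n C) (walks n)"

text \<open>Invariant of the reachable states. The occupied bottom makes every walk hit
  \<open>C\<close>; the occupied child of each nonempty occupied vertex shows that an empty level
  has nothing occupied above it (\<open>cluster_downward\<close>).\<close>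

definition cluster :: "nat \<Rightarrow> nat set set \<Rightarrow> bool" where
  "cluster n C \<longleftrightarrow> {} \<in> C \<and> C \<subseteq> Pow {0..<n} \<and> (\<forall>v\<in>C. v \<noteq> {} \<longrightarrow> (\<exists>i\<in>v. v - {i} \<in> C))"

lemma dla_step_eq:
  "dla_step n C = (if {0..<n} \<in> C then return_pmf C else map_pmf (\<lambda>v. insert v C) (site_pmf n C))"
  unfolding dla_step_def site_pmf_def dla_site_def by (simp add: map_pmf_comp Un_commute)

text \<open>Eliminates \<open>LEAST\<close>. Every walk ends in the occupied bottom, so the hitting
  index exists; the top is vacant, so that index is positive and the truncated subtraction of 1 is
  harmless. From here on an attachment is an event about consecutive vertices of the walk.\<close>

lemma dla_site_iff:
  assumes "cluster n C" "{0..<n} \<notin> C" "\<sigma> \<in> permutations_of_set {0..<n}" "v \<subseteq> {0..<n}"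
  shows "dla_site n C \<sigma> = v \<longleftrightarrow> v \<noteq> {} \<and> walk_vertex n \<sigma> (n - card v) = v \<and>
    walk_vertex n \<sigma> (Suc (n - card v)) \<in> C \<and> (\<forall>i\<le>n - card v. walk_vertex n \<sigma> i \<notin> C)"
proof -
  define h where "h = (LEAST j. walk_vertex n \<sigma> j \<in> C)"
  have e: "walk_vertex n \<sigma> n \<in> C" using assms walk_vertex_end by (auto simp: cluster_def)
  have h: "walk_vertex n \<sigma> h \<in> C" unfolding h_def by (rule LeastI, rule e)
  have hn: "h \<le> n" unfolding h_def by (rule Least_le, rule e)
  have less: "walk_vertex n \<sigma> i \<notin> C" if "i < h" for i
    using that not_less_Least unfolding h_def by blast
  have h0: "h > 0" using h assms(2) walk_vertex_0 by (metis neq0_conv)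
  have site: "dla_site n C \<sigma> = walk_vertex n \<sigma> (h - 1)" by (simp add: dla_site_def h_def)
  have cs: "card (walk_vertex n \<sigma> (h - 1)) = n - (h - 1)"
    using assms hn by (intro card_walk_vertex) auto
  show ?thesis
  proof
    assume "dla_site n C \<sigma> = v"
    hence v: "v = walk_vertex n \<sigma> (h - 1)" "card v = n - (h - 1)" using site cs by auto
    have "n - card v = h - 1" using v(2) hn h0 by auto
    moreover have "v \<noteq> {}" using v(2) hn h0 by auto
    ultimately show "v \<noteq> {} \<and> walk_vertex n \<sigma> (n - card v) = v \<and>
      walk_vertex n \<sigma> (Suc (n - card v)) \<in> C \<and> (\<forall>i\<le>n - card v. walk_vertex n \<sigma> i \<notin> C)"
      using v h h0 less by auto
  next
    assume a: "v \<noteq> {} \<and> walk_vertex n \<sigma> (n - card v) = v \<and>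
      walk_vertex n \<sigma> (Suc (n - card v)) \<in> C \<and> (\<forall>i\<le>n - card v. walk_vertex n \<sigma> i \<notin> C)"
    have "h \<le> Suc (n - card v)" unfolding h_def by (rule Least_le) (use a in blast)
    moreover have "\<not> h \<le> n - card v" using a h by blast
    ultimately have "h - 1 = n - card v" by linarith
    thus "dla_site n C \<sigma> = v" using a site by simp
  qed
qed

lemma dla_site_subset: "dla_site n C \<sigma> \<subseteq> {0..<n}"
  by (simp add: dla_site_def walk_vertex_subset)

lemma dla_site_properties:
  assumes "cluster n C" "{0..<n} \<notin> C" "\<sigma> \<in> permutations_of_set {0..<n}"
  shows "dla_site n C \<sigma> \<notin> C" "dla_site n C \<sigma> \<noteq> {}"
    "\<exists>i\<in>dla_site n C \<sigma>. dla_site n C \<sigma> - {i} \<in> C"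
proof -
  let ?v = "dla_site n C \<sigma>"
  have a: "?v \<noteq> {} \<and> walk_vertex n \<sigma> (n - card ?v) = ?v \<and>
      walk_vertex n \<sigma> (Suc (n - card ?v)) \<in> C \<and> (\<forall>i\<le>n - card ?v. walk_vertex n \<sigma> i \<notin> C)"
    using dla_site_iff[OF assms dla_site_subset[of n C \<sigma>]] by simp
  show "?v \<notin> C" using a by (metis order_refl)
  show "?v \<noteq> {}" using a by simp
  have "finite ?v" by (rule finite_subset[OF dla_site_subset]) simp
  hence "card ?v > 0" using a by (simp add: card_gt_0_iff)
  hence "n - card ?v < n" using card_mono[OF _ dla_site_subset[of n C \<sigma>]] by auto
  from walk_vertex_Suc[OF assms(3) this] show "\<exists>i\<in>?v. ?v - {i} \<in> C" using a by metis
qed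

lemma set_site_pmf: "set_pmf (site_pmf n C) = dla_site n C ` permutations_of_set {0..<n}"
  by (simp add: site_pmf_def)

lemma pmf_site_pmf: "pmf (site_pmf n C) v = measure_pmf.prob (walks n) {\<sigma>. dla_site n C \<sigma> = v}"
  by (simp add: site_pmf_def pmf_map vimage_def)

lemma pmf_site_eq:
  assumes "cluster n C" "{0..<n} \<notin> C" "v \<subseteq> {0..<n}" "v \<noteq> {}"
  shows "pmf (site_pmf n C) v = measure_pmf.prob (walks n)
    {\<sigma>. walk_vertex n \<sigma> (n - card v) = v \<and> walk_vertex n \<sigma> (Suc (n - card v)) \<in> C \<and>
        (\<forall>i\<le>n - card v. walk_vertex n \<sigma> i \<notin> C)}"
  unfolding pmf_site_pmf
  by (rule measure_pmf.finite_measure_eq_AE)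
     (use assms in \<open>auto simp: AE_measure_pmf_iff dla_site_iff\<close>)

lemma site_pmf_outside:
  assumes "cluster n C" "{0..<n} \<notin> C" "v \<in> C \<or> v = {} \<or> \<not> v \<subseteq> {0..<n}"
  shows "pmf (site_pmf n C) v = 0"
  using assms dla_site_properties dla_site_subset
  by (fastforce simp: set_site_pmf pmf_eq_0_set_pmf)

lemma site_pmf_le:
  assumes "cluster n C" "{0..<n} \<notin> C" "v \<subseteq> {0..<n}"
  shows "pmf (site_pmf n C) v \<le> 1 / real (n choose card v)"
proof (cases "v = {}")
  case False
  show ?thesis
    unfolding pmf_site_eq[OF assms False] prob_walk_vertex[OF assms(3), symmetric]
    by (intro measure_pmf.finite_measure_mono) auto
qed (use site_pmf_outside[OF assms(1,2)] in auto)

lemma finite_level [simp]: "finite (level n k)"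
  by (rule finite_subset[of _ "Pow {0..<n}"]) (auto simp: level_def)

lemma card_level: "card (level n k) = n choose k"
  using n_subsets[of "{0..<n}" k] by (simp add: level_def)

text \<open>To attach on level j + 1 the walk must be stopped by an occupied vertex of level j, and
  each of these lies on the walk with probability 1/(n choose j). This is what makes the cluster
  climb slowly.\<close>

lemma sum_site_pmf_level_le:
  assumes "cluster n C" "{0..<n} \<notin> C"
  shows "(\<Sum>v\<in>level n (Suc j). pmf (site_pmf n C) v) \<le> real (card (C \<inter> level n j)) / real (n choose j)"
proof -
  have "(\<Sum>v\<in>level n (Suc j). pmf (site_pmf n C) v) = measure_pmf.prob (site_pmf n C) (level n (Suc j))"
    by (simp add: measure_measure_pmf_finite)
  also have "\<dots> = measure_pmf.prob (walks n) {\<sigma>. dla_site n C \<sigma> \<in> level n (Suc j)}"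
    by (simp add: site_pmf_def vimage_def)
  also have "\<dots> \<le> measure_pmf.prob (walks n) (\<Union>z\<in>C \<inter> level n j. {\<sigma>. walk_vertex n \<sigma> (n - card z) = z})"
  proof (rule measure_pmf.finite_measure_mono_AE)
    show "AE \<sigma> in walks n. \<sigma> \<in> {\<sigma>. dla_site n C \<sigma> \<in> level n (Suc j)} \<longrightarrow>
        \<sigma> \<in> (\<Union>z\<in>C \<inter> level n j. {\<sigma>. walk_vertex n \<sigma> (n - card z) = z})"
    proof (simp add: AE_measure_pmf_iff, intro ballI impI)
      fix \<sigma> assume s: "\<sigma> \<in> permutations_of_set {0..<n}" "dla_site n C \<sigma> \<in> level n (Suc j)"
      let ?v = "dla_site n C \<sigma>"
      have c: "card ?v = Suc j" "?v \<subseteq> {0..<n}" using s by (auto simp: level_def)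
      have jn: "Suc j \<le> n" using c card_mono[OF _ c(2)] by auto
      have "walk_vertex n \<sigma> (Suc (n - card ?v)) \<in> C"
        using dla_site_iff[OF assms s(1) c(2)] by simp
      moreover have "Suc (n - card ?v) = n - j" using c jn by auto
      ultimately have z: "walk_vertex n \<sigma> (n - j) \<in> C" by simp
      have "card (walk_vertex n \<sigma> (n - j)) = j" using card_walk_vertex[OF s(1), of "n - j"] jn by simp
      with z show "\<exists>z\<in>C \<inter> level n j. walk_vertex n \<sigma> (n - card z) = z"
        by (intro bexI[of _ "walk_vertex n \<sigma> (n - j)"]) (auto simp: level_def walk_vertex_def)
    qed
  qed auto
  also have "\<dots> \<le> (\<Sum>z\<in>C \<inter> level n j. measure_pmf.prob (walks n) {\<sigma>. walk_vertex n \<sigma> (n - card z) = z})"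
    by (rule measure_pmf.finite_measure_subadditive_finite) auto
  also have "\<dots> = (\<Sum>z\<in>C \<inter> level n j. 1 / real (n choose j))"
    by (rule sum.cong) (auto simp: level_def prob_walk_vertex)
  finally show ?thesis by simp
qed

text \<open>A union bound for the probability that the walk, conditioned to pass through \<open>x\<close>, meets
  \<open>C\<close> strictly above \<open>x\<close>.\<close>

definition blockage :: "nat \<Rightarrow> nat set \<Rightarrow> nat set set \<Rightarrow> real" where
  "blockage n x C = (\<Sum>v\<in>{v \<in> C. x \<subset> v}. 1 / real ((n - card x) choose (card v - card x)))"

text \<open>A walk through \<open>x\<close> to one of its occupied children attaches at
  \<open>x\<close> unless it met \<open>C\<close> strictly above \<open>x\<close>. The first event
  is a disjoint union over the children and has an exact probability; the second is paid for by the
  union bound \<open>blockage\<close>.\<close>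

lemma site_pmf_ge:
  assumes "cluster n C" "{0..<n} \<notin> C" "x \<subseteq> {0..<n}" "x \<noteq> {}" "x \<notin> C"
  shows "pmf (site_pmf n C) x \<ge>
    (real (card {i\<in>x. x - {i} \<in> C}) / real (card x) - blockage n x C) / real (n choose card x)"
proof -
  let ?k = "card x"
  have fx: "finite x" using assms finite_subset by blast
  have k: "?k > 0" "?k \<le> n" using assms fx card_mono[OF _ assms(3)] by (auto simp: card_gt_0_iff)
  have bx: "real (n choose ?k) > 0" using k by simp
  let ?P = "measure_pmf.prob (walks n)"
  define through where "through v = {\<sigma>. walk_vertex n \<sigma> (n - card v) = v}" for v
  have fC: "finite {v \<in> C. x \<subset> v}"
    by (rule finite_subset[of _ "Pow {0..<n}"]) (use assms(1) in \<open>auto simp: cluster_def\<close>)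
  let ?D = "{i\<in>x. x - {i} \<in> C}"
  let ?G = "\<Union>i\<in>?D. through x \<inter> through (x - {i})"
  let ?B = "\<Union>v\<in>{v \<in> C. x \<subset> v}. through v \<inter> through x"
  have "?P ?G = (\<Sum>i\<in>?D. ?P (through x \<inter> through (x - {i})))"
  proof (rule measure_pmf.finite_measure_finite_Union)
    show "disjoint_family_on (\<lambda>i. through x \<inter> through (x - {i})) ?D"
      using fx by (auto simp: disjoint_family_on_def through_def)
  qed (use fx in auto)
  also have "\<dots> = (\<Sum>i\<in>?D. 1 / (real (n choose ?k) * real ?k))"
  proof (rule sum.cong)
    fix i assume i: "i \<in> ?D"
    hence "card (x - {i}) = ?k - 1" by simp
    moreover have "?k choose (?k - 1) = ?k" using k binomial_symmetric[of 1 ?k] by simp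
    ultimately show "?P (through x \<inter> through (x - {i})) = 1 / (real (n choose ?k) * real ?k)"
      using prob_walk_two_vertices[of "x - {i}" x n] assms(3)
      by (simp add: through_def Collect_conj_eq Diff_subset)
  qed simp
  finally have G: "?P ?G = real (card ?D) / real ?k / real (n choose ?k)" by simp
  have "?P ?B \<le> (\<Sum>v\<in>{v \<in> C. x \<subset> v}. ?P (through v \<inter> through x))"
    by (rule measure_pmf.finite_measure_subadditive_finite) (use fC in auto)
  also have "\<dots> = (\<Sum>v\<in>{v \<in> C. x \<subset> v}. 1 / real ((n - ?k) choose (card v - ?k)) / real (n choose ?k))"
  proof (rule sum.cong)
    fix v assume v: "v \<in> {v \<in> C. x \<subset> v}"
    hence vn: "v \<subseteq> {0..<n}" "x \<subseteq> v" using assms(1) by (auto simp: cluster_def)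
    have c: "?k \<le> card v" "card v \<le> n"
      using vn card_mono[OF _ vn(1)] finite_subset[OF vn(1)] by (auto intro: card_mono)
    \<comment> \<open>Choosing \<open>v\<close> and then \<open>x\<close> inside it equals choosing
      \<open>x\<close> and then \<open>v\<close> above it. This factors the joint probability into
      that of \<open>x\<close> and the conditional one of \<open>v\<close>, as in
      \<open>blockage\<close>.\<close>
    have "(n choose card v) * (card v choose ?k) = (n choose ?k) * ((n - ?k) choose (card v - ?k))"
      using c by (simp add: choose_mult)
    hence "real (n choose card v) * real (card v choose ?k)
       = real (n choose ?k) * real ((n - ?k) choose (card v - ?k))"
      by (metis of_nat_mult)
    thus "?P (through v \<inter> through x) = 1 / real ((n - ?k) choose (card v - ?k)) / real (n choose ?k)"
      using prob_walk_two_vertices[OF vn(2,1)] by (simp add: through_def Collect_conj_eq mult.commute)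
  qed simp
  also have "\<dots> = blockage n x C / real (n choose ?k)"
    by (simp add: blockage_def sum_divide_distrib)
  finally have B: "?P ?B \<le> blockage n x C / real (n choose ?k)" .
  have "?P ?G \<le> ?P (?B \<union> {\<sigma>. dla_site n C \<sigma> = x})"
  proof (rule measure_pmf.finite_measure_mono_AE)
    show "AE \<sigma> in walks n. \<sigma> \<in> ?G \<longrightarrow> \<sigma> \<in> ?B \<union> {\<sigma>. dla_site n C \<sigma> = x}"
    proof (simp only: AE_measure_pmf_iff set_pmf_walks, intro ballI impI)
      fix \<sigma> assume s: "\<sigma> \<in> permutations_of_set {0..<n}" "\<sigma> \<in> ?G"
      then obtain i where i: "i \<in> x" "x - {i} \<in> C" "walk_vertex n \<sigma> (n - ?k) = x"
        "walk_vertex n \<sigma> (n - card (x - {i})) = x - {i}" by (auto simp: through_def)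
      have "n - card (x - {i}) = Suc (n - ?k)" using i(1) k by simp
      hence nx: "walk_vertex n \<sigma> (Suc (n - ?k)) \<in> C" using i by metis
      show "\<sigma> \<in> ?B \<union> {\<sigma>. dla_site n C \<sigma> = x}"
      proof (cases "\<forall>j\<le>n - ?k. walk_vertex n \<sigma> j \<notin> C")
        case True
        thus ?thesis using dla_site_iff[OF assms(1,2) s(1) assms(3)] i nx assms by auto
      next
        case False
        then obtain j where j: "j \<le> n - ?k" "walk_vertex n \<sigma> j \<in> C" by blast
        have "x \<subset> walk_vertex n \<sigma> j"
          using walk_vertex_antimono[OF j(1), of n \<sigma>] i(3) j(2) assms(5) by auto
        moreover have "n - card (walk_vertex n \<sigma> j) = j"
          using card_walk_vertex[OF s(1), of j] j(1) by auto
        ultimately show ?thesis using j i(3) by (auto simp: through_def)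
      qed
    qed
  qed auto
  also have "\<dots> \<le> ?P ?B + pmf (site_pmf n C) x"
    unfolding pmf_site_pmf by (rule measure_Un_le) auto
  finally show ?thesis using G B by (simp add: diff_divide_distrib)
qed

text \<open>Given that the walk reaches \<open>y\<close> without having met \<open>C\<close>, its next vertex is uniform among the
  children of \<open>y\<close>: exchanging two coordinates of \<open>y\<close> does not affect the walk above \<open>y\<close>.\<close>

definition free_step_prob :: "nat \<Rightarrow> nat set set \<Rightarrow> nat set \<Rightarrow> nat \<Rightarrow> real" where
  "free_step_prob n C y i = measure_pmf.prob (walks n)
    {\<sigma>. walk_vertex n \<sigma> (n - card y) = y \<and> walk_vertex n \<sigma> (Suc (n - card y)) = y - {i} \<and>
        (\<forall>j\<le>n - card y. walk_vertex n \<sigma> j \<notin> C)}"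

lemma free_step_prob_uniform:
  assumes "y \<subseteq> {0..<n}" "i \<in> y" "i' \<in> y"
  shows "free_step_prob n C y i = free_step_prob n C y i'"
proof -
  let ?t = "Transposition.transpose i i'"
  define m where "m = n - card y"
  define E where "E i = {\<sigma> \<in> permutations_of_set {0..<n}. walk_vertex n \<sigma> m = y \<and>
      walk_vertex n \<sigma> (Suc m) = y - {i} \<and> (\<forall>j\<le>m. walk_vertex n \<sigma> j \<notin> C)}" for i
  have tt: "map ?t (map ?t \<sigma>) = \<sigma>" for \<sigma> by (simp add: comp_def)
  have tU: "?t ` {0..<n} = {0..<n}" using assms by (intro transpose_image_eq) auto
  have ty: "?t ` y = y" using assms by (intro transpose_image_eq) auto
  have perm: "map ?t \<sigma> \<in> permutations_of_set {0..<n}" if "\<sigma> \<in> permutations_of_set {0..<n}" for \<sigma>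
    using that tU by (auto simp: permutations_of_set_def distinct_map intro: inj_on_subset)
  have wv: "walk_vertex n (map ?t \<sigma>) j = ?t ` walk_vertex n \<sigma> j" for \<sigma> j
    unfolding walk_vertex_def using tU image_set_diff[of ?t "{0..<n}"] by (simp add: take_map)
  \<comment> \<open>Down to index \<open>m\<close> every vertex of the walk contains
    \<open>y\<close>, hence both \<open>i\<close> and \<open>i'\<close>, so the transposition fixes
    it.\<close>
  have sup: "walk_vertex n (map ?t \<sigma>) j = walk_vertex n \<sigma> j" 
    if "walk_vertex n \<sigma> m = y" "j \<le> m" for \<sigma> j
  proof -
    have "y \<subseteq> walk_vertex n \<sigma> j" using walk_vertex_antimono[OF that(2), of n \<sigma>] that(1) by simp
    thus ?thesis unfolding wv using assms by (intro transpose_image_eq) auto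
  qed
  have E1: "map ?t \<sigma> \<in> E b" if "\<sigma> \<in> E a" "?t a = b" for \<sigma> a b
  proof -
    have s: "\<sigma> \<in> permutations_of_set {0..<n}" "walk_vertex n \<sigma> m = y"
      "walk_vertex n \<sigma> (Suc m) = y - {a}" "\<forall>j\<le>m. walk_vertex n \<sigma> j \<notin> C"
      using that by (auto simp: E_def)
    have "walk_vertex n (map ?t \<sigma>) (Suc m) = y - {b}"
      unfolding wv s(3) using ty that(2) by (simp add: image_set_diff)
    thus ?thesis unfolding E_def using perm[OF s(1)] sup[OF s(2)] s by auto
  qed
  have "bij_betw (map ?t) (E i) (E i')"
    by (rule bij_betw_byWitness[where f' = "map ?t"]) (use tt E1[of _ i i'] E1[of _ i' i] in auto)
  hence "card (E i) = card (E i')" by (rule bij_betw_same_card)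
  moreover have "free_step_prob n C y a = real (card (E a)) / real (fact n)" for a
    unfolding free_step_prob_def E_def m_def
    by (subst measure_pmf_of_set) (auto simp: Int_def)
  ultimately show ?thesis by simp
qed

text \<open>The walk attaches at \<open>y\<close> iff it reaches \<open>y\<close> freely and steps
  to an occupied child, and each child is as likely as \<open>i\<close>. For a vacant child
  \<open>y - {i}\<close> this compares losing the access \<open>y\<close> with stepping from
  \<open>y\<close> to that child.\<close>

lemma site_pmf_eq_free_step:
  assumes "cluster n C" "{0..<n} \<notin> C" "y \<subseteq> {0..<n}" "i \<in> y"
  shows "pmf (site_pmf n C) y = real (card {j\<in>y. y - {j} \<in> C}) * free_step_prob n C y i"
proof -
  have fy: "finite y" using assms finite_subset by blast
  have c: "card y > 0" "card y \<le> n" using assms fy card_mono[OF _ assms(3)] by (auto simp: card_gt_0_iff)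
  let ?D = "{j\<in>y. y - {j} \<in> C}"
  define F where "F j = {\<sigma>. walk_vertex n \<sigma> (n - card y) = y \<and> walk_vertex n \<sigma> (Suc (n - card y)) = y - {j} \<and>
        (\<forall>j\<le>n - card y. walk_vertex n \<sigma> j \<notin> C)}" for j
  have "pmf (site_pmf n C) y = measure_pmf.prob (walks n) (\<Union>j\<in>?D. F j)"
    unfolding pmf_site_pmf
  proof (rule measure_pmf.finite_measure_eq_AE)
    show "AE \<sigma> in walks n. (\<sigma> \<in> {\<sigma>. dla_site n C \<sigma> = y}) = (\<sigma> \<in> (\<Union>j\<in>?D. F j))"
    proof (simp only: AE_measure_pmf_iff set_pmf_walks, intro ballI)
      fix \<sigma> assume s: "\<sigma> \<in> permutations_of_set {0..<n}"
      have "walk_vertex n \<sigma> (Suc (n - card y)) = walk_vertex n \<sigma> (n - card y) - {\<sigma> ! (n - card y)}"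
        "\<sigma> ! (n - card y) \<in> walk_vertex n \<sigma> (n - card y)"
        using walk_vertex_Suc[OF s, of "n - card y"] c by auto
      thus "(\<sigma> \<in> {\<sigma>. dla_site n C \<sigma> = y}) = (\<sigma> \<in> (\<Union>j\<in>?D. F j))"
        using dla_site_iff[OF assms(1,2) s assms(3)] assms(4) unfolding F_def by auto
    qed
  qed auto
  also have "\<dots> = (\<Sum>j\<in>?D. measure_pmf.prob (walks n) (F j))"
    by (rule measure_pmf.finite_measure_finite_Union)
       (use fy in \<open>auto simp: disjoint_family_on_def F_def\<close>)
  also have "\<dots> = (\<Sum>j\<in>?D. free_step_prob n C y i)"
    using free_step_prob_uniform[OF assms(3) _ assms(4)]
    by (intro sum.cong) (auto simp: free_step_prob_def F_def)
  finally show ?thesis by simp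
qed

text \<open>A walk that attaches at \<open>x\<close> entered it freely through a vacant parent.
  There is only an inequality, because a walk that enters \<open>x\<close> may continue to a vacant
  child.\<close>

lemma site_pmf_le_free_steps:
  assumes "cluster n C" "{0..<n} \<notin> C" "x \<subset> {0..<n}" "x \<noteq> {}"
  shows "pmf (site_pmf n C) x \<le> (\<Sum>i\<in>{i\<in>{0..<n} - x. insert i x \<notin> C}. free_step_prob n C (insert i x) i)"
proof -
  have fx: "finite x" using assms finite_subset by blast
  have c: "card x > 0" "card x < n"
    using assms fx psubset_card_mono[OF _ assms(3)] by (auto simp: card_gt_0_iff)
  let ?D = "{i\<in>{0..<n} - x. insert i x \<notin> C}"
  define F where "F i = {\<sigma>. walk_vertex n \<sigma> (n - card (insert i x)) = insert i x \<and>
      walk_vertex n \<sigma> (Suc (n - card (insert i x))) = insert i x - {i} \<and>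
        (\<forall>j\<le>n - card (insert i x). walk_vertex n \<sigma> j \<notin> C)}" for i
  have "pmf (site_pmf n C) x \<le> measure_pmf.prob (walks n) (\<Union>i\<in>?D. F i)"
    unfolding pmf_site_pmf
  proof (rule measure_pmf.finite_measure_mono_AE)
    show "AE \<sigma> in walks n. \<sigma> \<in> {\<sigma>. dla_site n C \<sigma> = x} \<longrightarrow> \<sigma> \<in> (\<Union>i\<in>?D. F i)"
    proof (simp only: AE_measure_pmf_iff set_pmf_walks, intro ballI impI)
      fix \<sigma> assume s: "\<sigma> \<in> permutations_of_set {0..<n}" "\<sigma> \<in> {\<sigma>. dla_site n C \<sigma> = x}"
      define m where "m = n - Suc (card x)"
      have m: "n - card x = Suc m" "m < n" using c by (auto simp: m_def)
      have x: "walk_vertex n \<sigma> (Suc m) = x" "\<forall>i\<le>Suc m. walk_vertex n \<sigma> i \<notin> C"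
        using s dla_site_iff[OF assms(1,2) s(1), of x] assms(3) m by auto
      define i where "i = \<sigma> ! m"
      have i: "x = walk_vertex n \<sigma> m - {i}" "i \<in> walk_vertex n \<sigma> m"
        using walk_vertex_Suc[OF s(1) m(2)] x by (auto simp: i_def)
      hence w: "walk_vertex n \<sigma> m = insert i x" "i \<notin> x" "i \<in> {0..<n}"
        using walk_vertex_subset[of n \<sigma> m] by auto
      have "card (insert i x) = Suc (card x)" using w fx by simp
      hence "n - card (insert i x) = m" by (simp add: m_def)
      moreover have "insert i x \<notin> C" using x(2) w(1) by (metis le_SucI order_refl)
      ultimately have "\<sigma> \<in> F i" "i \<in> ?D" unfolding F_def using w x by auto
      thus "\<sigma> \<in> (\<Union>i\<in>?D. F i)" by blast
    qed
  qed auto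
  also have "\<dots> \<le> (\<Sum>i\<in>?D. measure_pmf.prob (walks n) (F i))"
    by (rule measure_pmf.finite_measure_subadditive_finite) auto
  finally show ?thesis by (simp add: free_step_prob_def F_def)
qed

section \<open>Expectations along the process\<close>

abbreviation expect :: "'a pmf \<Rightarrow> ('a \<Rightarrow> real) \<Rightarrow> real" where
  "expect p f \<equiv> measure_pmf.expectation p f"

lemma expect_mono:
  assumes "finite (set_pmf p)" "\<And>x. x \<in> set_pmf p \<Longrightarrow> f x \<le> g x"
  shows "expect p f \<le> expect p g"
  by (rule integral_mono_AE) (use assms in \<open>auto simp: AE_measure_pmf_iff integrable_measure_pmf_finite\<close>)

lemma expect_bind:
  assumes "finite (set_pmf p)" "\<And>x. x \<in> set_pmf p \<Longrightarrow> finite (set_pmf (q x))"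
  shows "expect (bind_pmf p q) f = expect p (\<lambda>x. expect (q x) f)"
  using pmf_expectation_bind[of "set_pmf p" q p f] assms
    integral_measure_pmf_real[OF assms(1), of p "\<lambda>x. expect (q x) f"]
  by (simp add: mult.commute)

lemma prob_le_expect:
  assumes "finite (set_pmf p)" "\<And>x. x \<in> set_pmf p \<Longrightarrow> 0 \<le> f x"
    "\<And>x. x \<in> set_pmf p \<Longrightarrow> x \<in> A \<Longrightarrow> 1 \<le> f x"
  shows "measure_pmf.prob p A \<le> expect p f"
proof -
  have "measure_pmf.prob p A = expect p (indicator A)" by simp
  also have "\<dots> \<le> expect p f"
    by (rule expect_mono) (use assms in \<open>auto simp: indicator_def\<close>)
  finally show ?thesis .
qed

text \<open>Conditioning on an intermediate state: \<open>B\<close> collects the exceptional states,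
  after which nothing is claimed.\<close>

lemma prob_bind_le:
  assumes "finite (set_pmf p)" "\<And>x. x \<in> set_pmf p \<Longrightarrow> finite (set_pmf (q x))"
    "0 \<le> c" "\<And>x. x \<in> set_pmf p \<Longrightarrow> x \<notin> B \<Longrightarrow> measure_pmf.prob (q x) A \<le> c"
  shows "measure_pmf.prob (bind_pmf p q) A \<le> measure_pmf.prob p B + c"
proof -
  have "measure_pmf.prob (bind_pmf p q) A = expect (bind_pmf p q) (indicator A)" by simp
  also have "\<dots> = expect p (\<lambda>x. measure_pmf.prob (q x) A)"
    using expect_bind[of p q "indicator A"] assms(1,2) by simp
  also have "\<dots> \<le> expect p (\<lambda>x. indicator B x + c)"
    by (rule expect_mono) (use assms in \<open>auto simp: indicator_def add_increasing2\<close>)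
  also have "\<dots> = measure_pmf.prob p B + c"
    using assms(1) by (simp add: integrable_measure_pmf_finite)
  finally show ?thesis .
qed

lemma finite_set_dla_step [simp]: "finite (set_pmf (dla_step n C))"
  by (simp add: dla_step_eq set_site_pmf)

lemma sum_site_pmf: "(\<Sum>v\<in>Pow {0..<n}. pmf (site_pmf n C) v) = 1"
  by (rule sum_pmf_eq_1) (use dla_site_subset in \<open>auto simp: set_site_pmf\<close>)

lemma expect_dla_step:
  assumes "{0..<n} \<notin> C"
  shows "expect (dla_step n C) f = (\<Sum>v\<in>Pow {0..<n}. f (insert v C) * pmf (site_pmf n C) v)"
proof -
  have "expect (dla_step n C) f = expect (site_pmf n C) (\<lambda>v. f (insert v C))"
    using assms by (simp add: dla_step_eq)
  also have "\<dots> = (\<Sum>v\<in>Pow {0..<n}. f (insert v C) * pmf (site_pmf n C) v)"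
    by (rule integral_measure_pmf_real) (use dla_site_subset in \<open>auto simp: set_site_pmf\<close>)
  finally show ?thesis .
qed

lemma dla_step_cases:
  assumes "cluster n C" "C' \<in> set_pmf (dla_step n C)"
  obtains "{0..<n} \<in> C" "C' = C"
  | v where "{0..<n} \<notin> C" "C' = insert v C" "v \<in> Pow {0..<n} - C" "v \<noteq> {}" "\<exists>i\<in>v. v - {i} \<in> C"
proof (cases "{0..<n} \<in> C")
  case False
  then obtain \<sigma> where "\<sigma> \<in> permutations_of_set {0..<n}" "C' = insert (dla_site n C \<sigma>) C"
    using assms(2) by (auto simp: dla_step_eq set_site_pmf)
  with that(2)[of "dla_site n C \<sigma>"] dla_site_properties[OF assms(1) False] dla_site_subset[of n C \<sigma>] False
  show ?thesis by auto
qed (use assms that in \<open>auto simp: dla_step_eq\<close>)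

lemma cluster_step:
  assumes "cluster n C" "C' \<in> set_pmf (dla_step n C)"
  shows "cluster n C'"
  using dla_step_cases[OF assms] assms(1) by (cases; auto simp: cluster_def)

lemma step_superset:
  assumes "cluster n C" "C' \<in> set_pmf (dla_step n C)"
  shows "C \<subseteq> C'"
  using dla_step_cases[OF assms] by cases auto

text \<open>The process restarted from a given state. It is unrolled at its first step, whereas
  \<open>dla_state\<close> is unrolled at its last, so that inductions can run over the number of
  remaining steps.\<close>

primrec dla_run :: "nat \<Rightarrow> nat \<Rightarrow> nat set set \<Rightarrow> nat set set pmf" where
  "dla_run n 0 C = return_pmf C"
| "dla_run n (Suc s) C = bind_pmf (dla_step n C) (dla_run n s)"

lemma finite_set_dla_run [simp]: "finite (set_pmf (dla_run n s C))"
  by (induction s arbitrary: C) auto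

lemma finite_set_dla_state [simp]: "finite (set_pmf (dla_state n t))"
  by (induction t) auto

lemma dla_state_add: "dla_state n (t + s) = bind_pmf (dla_state n t) (dla_run n s)"
proof (induction s arbitrary: t)
  case (Suc s)
  have "dla_state n (t + Suc s) = dla_state n (Suc t + s)" by simp
  also have "\<dots> = bind_pmf (dla_state n t) (\<lambda>C. bind_pmf (dla_step n C) (dla_run n s))"
    unfolding Suc.IH by (simp add: bind_assoc_pmf)
  finally show ?case by simp
next
  case 0
  have "dla_run n 0 = return_pmf" by (rule ext) simp
  thus ?case by (simp add: bind_return_pmf')
qed

lemma dla_state_eq_run: "dla_state n t = dla_run n t {{}}"
  using dla_state_add[of n 0 t] by (simp add: bind_return_pmf)

lemma cluster_initial [simp]: "cluster n {{}}"
  by (simp add: cluster_def)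

lemma set_dla_run:
  assumes "cluster n C" "C' \<in> set_pmf (dla_run n s C)"
  shows "cluster n C'" "C \<subseteq> C'"
proof -
  have "cluster n C' \<and> C \<subseteq> C'"
    using assms
  proof (induction s arbitrary: C)
    case (Suc s)
    then obtain D where D: "D \<in> set_pmf (dla_step n C)" "C' \<in> set_pmf (dla_run n s D)" by auto
    show ?case
      using Suc.IH[OF cluster_step[OF Suc.prems(1) D(1)] D(2)] step_superset[OF Suc.prems(1) D(1)]
      by blast
  qed auto
  thus "cluster n C'" "C \<subseteq> C'" by auto
qed

lemma cluster_dla_state: "C \<in> set_pmf (dla_state n t) \<Longrightarrow> cluster n C"
  using set_dla_run(1)[OF cluster_initial] by (simp add: dla_state_eq_run)

text \<open>Optional stopping for a potential \<open>f\<close> indexed by the number of remaining steps.\<close>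

lemma expect_dla_run_le:
  assumes step: "\<And>s C. P C \<Longrightarrow> cluster n C \<Longrightarrow> expect (dla_step n C) (f s) \<le> f (Suc s) C"
    and mono: "\<And>C C'. P C \<Longrightarrow> cluster n C \<Longrightarrow> C' \<in> set_pmf (dla_step n C) \<Longrightarrow> P C'"
    and init: "P C" "cluster n C"
  shows "expect (dla_run n s C) (f 0) \<le> f s C"
  using init
proof (induction s arbitrary: C)
  case (Suc s)
  have "expect (dla_run n (Suc s) C) (f 0) = expect (dla_step n C) (\<lambda>C'. expect (dla_run n s C') (f 0))"
    by (simp add: expect_bind)
  also have "\<dots> \<le> expect (dla_step n C) (f s)"
    by (rule expect_mono) (use Suc mono cluster_step in auto)
  also have "\<dots> \<le> f (Suc s) C" by (rule step) (use Suc in auto)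
  finally show ?case .
qed simp

lemma expect_step_le:
  assumes "cluster n C" "f C \<le> B"
    "{0..<n} \<notin> C \<Longrightarrow> (\<Sum>v\<in>Pow {0..<n}. f (insert v C) * pmf (site_pmf n C) v) \<le> B"
  shows "expect (dla_step n C) f \<le> B"
proof (cases "{0..<n} \<in> C")
  case True
  thus ?thesis using assms(2) by (simp add: dla_step_eq)
qed (use assms expect_dla_step in auto)

section \<open>High levels are reached late\<close>

lemma card_cluster_level_state_le:
  assumes "C \<in> set_pmf (dla_state n t)" "0 < m"
  shows "card (C \<inter> level n m) \<le> t"
  using assms(1)
proof (induction t arbitrary: C)
  case 0
  thus ?case using assms(2) by (auto simp: level_def)
next
  case (Suc t)
  then obtain C0 where C0: "C0 \<in> set_pmf (dla_state n t)" "C \<in> set_pmf (dla_step n C0)" by auto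
  from dla_step_cases[OF cluster_dla_state[OF C0(1)] C0(2)] show ?case
  proof cases
    case (2 v)
    have "card (C \<inter> level n m) \<le> card (insert v (C0 \<inter> level n m))"
      using 2 by (intro card_mono) auto
    also have "\<dots> \<le> Suc (card (C0 \<inter> level n m))" by (simp add: card_insert_if)
    finally show ?thesis using Suc.IH[OF C0(1)] by linarith
  qed (use Suc.IH[OF C0(1)] in auto)
qed

lemma expect_step_card_level:
  assumes "cluster n C"
  shows "expect (dla_step n C) (\<lambda>C. real (card (C \<inter> level n (Suc j))))
    \<le> real (card (C \<inter> level n (Suc j))) + real (card (C \<inter> level n j)) / real (n choose j)"
proof (rule expect_step_le[OF assms])
  assume top: "{0..<n} \<notin> C"
  let ?s = "pmf (site_pmf n C)" and ?L = "level n (Suc j)"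
  have LP: "?L \<subseteq> Pow {0..<n}" by (auto simp: level_def)
  have "(\<Sum>v\<in>Pow {0..<n}. real (card (insert v C \<inter> ?L)) * ?s v)
     \<le> (\<Sum>v\<in>Pow {0..<n}. (real (card (C \<inter> ?L)) + indicator ?L v) * ?s v)"
  proof (intro sum_mono mult_right_mono)
    fix v
    show "real (card (insert v C \<inter> ?L)) \<le> real (card (C \<inter> ?L)) + indicator ?L v"
      by (auto simp: indicator_def card_insert_if Int_insert_left)
  qed auto
  also have "\<dots> = real (card (C \<inter> ?L)) * (\<Sum>v\<in>Pow {0..<n}. ?s v) + (\<Sum>v\<in>Pow {0..<n}. indicator ?L v * ?s v)"
    by (simp add: algebra_simps sum.distrib sum_distrib_left)
  also have "(\<Sum>v\<in>Pow {0..<n}. indicator ?L v * ?s v) = (\<Sum>v\<in>?L. ?s v)"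
    using LP by (simp add: sum.inter_restrict[symmetric] indicator_def if_distrib[of "\<lambda>x. x * _"] Int_absorb1 cong: if_cong)
  finally show "(\<Sum>v\<in>Pow {0..<n}. real (card (insert v C \<inter> ?L)) * ?s v)
    \<le> real (card (C \<inter> ?L)) + real (card (C \<inter> level n j)) / real (n choose j)"
    using sum_site_pmf_level_le[OF assms top, of j] by (simp add: sum_site_pmf)
qed simp

text \<open>Each step adds at most one vertex to level m, which is the base. By
  \<open>expect_step_card_level\<close> the next level gains, in expectation, the current count
  below divided by the size of the level below; summing over at most T steps yields one factor T/(n
  choose (m + l)) per level.\<close>

lemma expect_card_level_le:
  assumes "0 < m" "t \<le> T"
  shows "expect (dla_state n t) (\<lambda>C. real (card (C \<inter> level n (m + i))))
     \<le> real t * (\<Prod>l<i. real T / real (n choose (m + l)))"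
  using assms(2)
proof (induction i arbitrary: t)
  case 0
  have "expect (dla_state n t) (\<lambda>C. real (card (C \<inter> level n (m + 0)))) \<le> expect (dla_state n t) (\<lambda>_. real t)"
    by (rule expect_mono) (use card_cluster_level_state_le assms(1) in auto)
  thus ?case by simp
next
  case (Suc i)
  define a where "a = (\<Prod>l<i. real T / real (n choose (m + l)))"
  have a0: "a \<ge> 0" unfolding a_def by (intro prod_nonneg) auto
  have IH: "expect (dla_state n t) (\<lambda>C. real (card (C \<inter> level n (m + i)))) \<le> real t * a" if "t \<le> T" for t
    using Suc.IH[OF that] by (simp add: a_def)
  show ?case using \<open>t \<le> T\<close>
  proof (induction t)
    case 0
    show ?case using assms(1) by (auto simp: level_def)
  next
    case (Suc t)
    let ?E = "expect (dla_state n t)"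
    let ?c = "\<lambda>j C. real (card (C \<inter> level n j))"
    have "expect (dla_state n (Suc t)) (?c (m + Suc i)) = ?E (\<lambda>C. expect (dla_step n C) (?c (m + Suc i)))"
      by (simp add: expect_bind)
    also have "\<dots> \<le> ?E (\<lambda>C. ?c (m + Suc i) C + ?c (m + i) C / real (n choose (m + i)))"
      by (rule expect_mono) (use expect_step_card_level cluster_dla_state in auto)
    also have "\<dots> = ?E (?c (m + Suc i)) + ?E (?c (m + i)) / real (n choose (m + i))"
      by (simp add: integrable_measure_pmf_finite)
    also have "\<dots> \<le> real t * (a * (real T / real (n choose (m + i)))) + real T * a / real (n choose (m + i))"
    proof (intro add_mono divide_right_mono)
      show "?E (?c (m + Suc i)) \<le> real t * (a * (real T / real (n choose (m + i))))"
        using Suc by (simp add: a_def)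
      have "?E (?c (m + i)) \<le> real t * a" using IH Suc by simp
      also have "\<dots> \<le> real T * a" using Suc a0 by (intro mult_right_mono) auto
      finally show "?E (?c (m + i)) \<le> real T * a" .
    qed auto
    also have "\<dots> = real (Suc t) * (\<Prod>l<Suc i. real T / real (n choose (m + l)))"
      by (simp add: a_def algebra_simps add_divide_distrib)
    finally show ?case .
  qed
qed

lemma cluster_downward:
  assumes "cluster n C" "v \<in> C" "J \<le> card v"
  shows "C \<inter> level n J \<noteq> {}"
  using assms(2,3)
proof (induction "card v - J" arbitrary: v)
  case 0
  thus ?case using assms(1) by (auto simp: level_def cluster_def)
next
  case (Suc d)
  hence "v \<noteq> {}" by auto
  then obtain i where i: "i \<in> v" "v - {i} \<in> C"
    using assms(1) Suc(3) unfolding cluster_def by blast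
  show ?case by (rule Suc(1)[of "v - {i}"]) (use i Suc in auto)
qed

lemma prob_level_occupied_le:
  assumes "0 < m" "t \<le> T"
  shows "measure_pmf.prob (dla_state n t) {C. C \<inter> level n (m + i) \<noteq> {}}
    \<le> real t * (\<Prod>l<i. real T / real (n choose (m + l)))"
proof -
  have "measure_pmf.prob (dla_state n t) {C. C \<inter> level n (m + i) \<noteq> {}}
      \<le> expect (dla_state n t) (\<lambda>C. real (card (C \<inter> level n (m + i))))"
  proof (rule prob_le_expect)
    fix C assume "C \<in> {C. C \<inter> level n (m + i) \<noteq> {}}"
    hence "0 < card (C \<inter> level n (m + i))" by (auto simp: card_gt_0_iff)
    thus "1 \<le> real (card (C \<inter> level n (m + i)))" by simp
  qed auto
  thus ?thesis using expect_card_level_le[OF assms, of n i] by linarith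
qed

section \<open>Blockage is small\<close>

lemma exp_le_one_plus_twice:
  fixes z :: real
  assumes "0 \<le> z" "z \<le> 1"
  shows "exp z - 1 \<le> 2 * z"
  using exp_bound[OF assms] assms power2_eq_square[of z] mult_left_le[of z z] by simp

lemma choose_ge_self: "1 \<le> i \<Longrightarrow> i < N \<Longrightarrow> N \<le> N choose i"
proof (induction N arbitrary: i)
  case (Suc N)
  show ?case
  proof (cases "i = N")
    case True
    thus ?thesis by simp
  next
    case False
    then obtain i' where i': "i = Suc i'" using Suc by (cases i) auto
    have "N \<le> N choose i" using Suc False by auto
    moreover have "1 \<le> N choose i'" using Suc i' by (simp add: Suc_le_eq)
    ultimately show ?thesis using i' by simp
  qed
qed auto

text \<open>The part of \<open>blockage\<close> up to level \<open>J\<close>. The cut excludes the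
  top, whose summand alone is 1 and would spoil the exponential moments; emptiness of the high
  levels is proved separately.\<close>

definition low_blockage :: "nat \<Rightarrow> nat \<Rightarrow> nat set \<Rightarrow> nat set set \<Rightarrow> real" where
  "low_blockage n J x C = (\<Sum>v\<in>{v \<in> C. x \<subset> v \<and> card v \<le> J}. 1 / real ((n - card x) choose (card v - card x)))"

text \<open>A vertex of level j above \<open>x\<close> raises the blockage by the reciprocal of the
  number of such vertices, and is attached with probability at most 1/(n choose j); so level j
  contributes at most 1/(n choose j) to the drift. The bound on \<open>\<mu>\<close> makes each jump
  of the exponent at most 1, where the exponential is bounded by a linear function.\<close>

lemma expect_exp_blockage_step:
  assumes C: "cluster n C" and x: "x \<subseteq> {0..<n}" and J: "J < n"
    and lam: "0 \<le> \<mu>" "\<mu> \<le> real (n - card x)"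
  shows "expect (dla_step n C) (\<lambda>C. exp (\<mu> * low_blockage n J x C))
    \<le> (1 + 2 * \<mu> * (\<Sum>j\<in>{card x<..J}. 1 / real (n choose j))) * exp (\<mu> * low_blockage n J x C)"
    (is "_ \<le> (1 + 2 * \<mu> * ?S) * ?F C")
proof (rule expect_step_le[OF C])
  let ?k = "card x"
  have S0: "?S \<ge> 0" by (intro sum_nonneg) auto
  show "?F C \<le> (1 + 2 * \<mu> * ?S) * ?F C" using S0 lam by simp
  assume top: "{0..<n} \<notin> C"
  let ?s = "pmf (site_pmf n C)"
  let ?A = "{v \<in> Pow {0..<n}. x \<subset> v \<and> card v \<le> J}"
  have fx: "finite x" using x finite_subset by blast
  have fC: "finite {v \<in> C. x \<subset> v \<and> card v \<le> J}"
    by (rule finite_subset[of _ "Pow {0..<n}"]) (use C in \<open>auto simp: cluster_def\<close>)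
  define z where "z v = 1 / real ((n - ?k) choose (card v - ?k))" for v :: "nat set"
  have ck: "?k < card v \<and> card v \<le> J" if "v \<in> ?A" for v
    using that by (metis (mono_tags, lifting) finite_atLeastLessThan finite_subset mem_Collect_eq PowD psubset_card_mono)
  have lz: "0 \<le> \<mu> * z v \<and> \<mu> * z v \<le> 1" if "v \<in> ?A" for v
  proof -
    have "n - ?k \<le> (n - ?k) choose (card v - ?k)" using ck[OF that] J by (intro choose_ge_self) auto
    hence "\<mu> \<le> real ((n - ?k) choose (card v - ?k))" using lam(2) by linarith
    moreover have "real ((n - ?k) choose (card v - ?k)) > 0" using ck[OF that] J
      by (simp add: zero_less_binomial_iff diff_le_mono)
    ultimately show ?thesis using lam(1) by (simp add: z_def)
  qed
  have summand: "?F (insert v C) * ?s v \<le> ?F C * (?s v + (if v \<in> ?A then 2 * \<mu> * z v / real (n choose card v) else 0))"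
    if v: "v \<in> Pow {0..<n}" for v
  proof (cases "v \<in> ?A \<and> v \<notin> C")
    case True
    have "{u \<in> insert v C. x \<subset> u \<and> card u \<le> J} = insert v {u \<in> C. x \<subset> u \<and> card u \<le> J}" using True by auto
    hence "low_blockage n J x (insert v C) = z v + low_blockage n J x C"
      using True fC by (simp add: low_blockage_def z_def)
    hence "?F (insert v C) * ?s v = ?F C * (?s v + (exp (\<mu> * z v) - 1) * ?s v)"
      by (simp add: algebra_simps exp_add)
    also have "\<dots> \<le> ?F C * (?s v + (2 * (\<mu> * z v)) * (1 / real (n choose card v)))"
      using lz[of v] True exp_le_one_plus_twice[of "\<mu> * z v"] site_pmf_le[OF C top, of v] v
      by (intro mult_left_mono add_left_mono mult_mono) auto
    finally show ?thesis using True by (simp add: mult.assoc)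
  next
    case False
    have "low_blockage n J x (insert v C) * ?s v = low_blockage n J x C * ?s v"
    proof (cases "v \<in> C")
      case True
      thus ?thesis by (simp add: insert_absorb)
    next
      case nC: False
      hence "{u \<in> insert v C. x \<subset> u \<and> card u \<le> J} = {u \<in> C. x \<subset> u \<and> card u \<le> J}" using False v by auto
      thus ?thesis by (simp add: low_blockage_def)
    qed
    hence "?F (insert v C) * ?s v = ?F C * ?s v" by auto
    also have "\<dots> \<le> ?F C * (?s v + (if v \<in> ?A then 2 * \<mu> * z v / real (n choose card v) else 0))"
      using lz[of v] by (intro mult_left_mono) auto
    finally show ?thesis .
  qed
  have "(\<Sum>v\<in>Pow {0..<n}. ?F (insert v C) * ?s v)
     \<le> (\<Sum>v\<in>Pow {0..<n}. ?F C * (?s v + (if v \<in> ?A then 2 * \<mu> * z v / real (n choose card v) else 0)))"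
    by (rule sum_mono) (use summand in auto)
  also have "\<dots> = ?F C * (1 + (\<Sum>v\<in>Pow {0..<n}. (if v \<in> ?A then 2 * \<mu> * z v / real (n choose card v) else 0)))"
    by (simp add: sum_distrib_left[symmetric] sum.distrib sum_site_pmf)
  also have "(\<Sum>v\<in>Pow {0..<n}. (if v \<in> ?A then 2 * \<mu> * z v / real (n choose card v) else 0))
     = (\<Sum>v\<in>?A. 2 * \<mu> * z v / real (n choose card v))"
    by (subst sum.inter_filter[symmetric]) (auto intro!: sum.cong)
  also have "\<dots> = (\<Sum>j\<in>{?k<..J}. \<Sum>v\<in>{v\<in>?A. card v = j}. 2 * \<mu> * z v / real (n choose card v))"
  proof (rule sum.group[symmetric])
    show "card ` ?A \<subseteq> {?k<..J}" using ck by (intro image_subsetI) (simp only: greaterThanAtMost_iff)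
  qed auto
  also have "\<dots> = (\<Sum>j\<in>{?k<..J}. 2 * \<mu> * (1 / real (n choose j)))"
  proof (rule sum.cong)
    fix j assume j: "j \<in> {?k<..J}"
    have "bij_betw (\<lambda>u. x \<union> u) {u. u \<subseteq> {0..<n} - x \<and> card u = j - ?k} {v\<in>?A. card v = j}"
    proof (rule bij_betw_byWitness[where f' = "\<lambda>v. v - x"])
      show "(\<lambda>v. v - x) ` {v\<in>?A. card v = j} \<subseteq> {u. u \<subseteq> {0..<n} - x \<and> card u = j - ?k}"
        using fx by (auto simp: card_Diff_subset)
      show "(\<lambda>u. x \<union> u) ` {u. u \<subseteq> {0..<n} - x \<and> card u = j - ?k} \<subseteq> {v\<in>?A. card v = j}"
      proof (rule image_subsetI)
        fix u assume "u \<in> {u. u \<subseteq> {0..<n} - x \<and> card u = j - ?k}"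
        hence u: "u \<subseteq> {0..<n} - x" "card u = j - ?k" by auto
        have "finite u" using u finite_subset by blast
        hence c: "card (x \<union> u) = j" using u fx j by (subst card_Un_disjoint) auto
        have "u \<noteq> {}" using u(2) j by auto
        hence "x \<subset> x \<union> u" using u by blast
        thus "x \<union> u \<in> {v\<in>?A. card v = j}" using u x c j by auto
      qed
    qed auto
    hence "card {v\<in>?A. card v = j} = card {u. u \<subseteq> {0..<n} - x \<and> card u = j - ?k}"
      by (simp add: bij_betw_same_card)
    also have "\<dots> = (n - ?k) choose (j - ?k)"
      using x fx by (subst n_subsets) (auto simp: card_Diff_subset)
    finally have cA: "card {v\<in>?A. card v = j} = (n - ?k) choose (j - ?k)" .
    have pos: "real ((n - ?k) choose (j - ?k)) > 0" using j J
      by (simp add: zero_less_binomial_iff diff_le_mono)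
    have "(\<Sum>v\<in>{v\<in>?A. card v = j}. 2 * \<mu> * z v / real (n choose card v))
      = (\<Sum>v\<in>{v\<in>?A. card v = j}. 2 * \<mu> * (1 / real ((n - ?k) choose (j - ?k))) / real (n choose j))"
      by (rule sum.cong) (auto simp: z_def)
    also have "\<dots> = 2 * \<mu> * (1 / real (n choose j))" using cA pos by simp
    finally show "(\<Sum>v\<in>{v\<in>?A. card v = j}. 2 * \<mu> * z v / real (n choose card v)) = 2 * \<mu> * (1 / real (n choose j))" .
  qed simp
  finally show "(\<Sum>v\<in>Pow {0..<n}. ?F (insert v C) * ?s v) \<le> (1 + 2 * \<mu> * ?S) * ?F C"
    by (simp add: sum_distrib_left mult.commute)
qed

text \<open>Chernoff bound with the largest parameter that the step estimate admits, n - |x|. The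
  resulting rate, linear in n, pays for a union bound over all \<open>x\<close> of a low
  level.\<close>

lemma prob_low_blockage:
  assumes x: "x \<subseteq> {0..<n}" and J: "J < n"
  shows "measure_pmf.prob (dla_state n t) {C. low_blockage n J x C \<ge> \<beta>}
    \<le> exp (- real (n - card x) * (\<beta> - 2 * real t * (\<Sum>j\<in>{card x<..J}. 1 / real (n choose j))))"
    (is "_ \<le> exp (- ?l * (\<beta> - 2 * real t * ?S))")
proof -
  define M where "M = 1 + 2 * ?l * ?S"
  have S0: "?S \<ge> 0" by (intro sum_nonneg) auto
  have M: "0 \<le> M" "M \<le> exp (2 * ?l * ?S)" unfolding M_def using S0 exp_ge_add_one_self by auto
  have "expect (dla_run n t {{}}) (\<lambda>C. M ^ 0 * exp (?l * low_blockage n J x C))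
     \<le> M ^ t * exp (?l * low_blockage n J x {{}})"
  proof (rule expect_dla_run_le[where P = "\<lambda>_. True" and f = "\<lambda>s C. M ^ s * exp (?l * low_blockage n J x C)"])
    fix s C assume C: "cluster n C"
    have "expect (dla_step n C) (\<lambda>C. exp (?l * low_blockage n J x C)) \<le> M * exp (?l * low_blockage n J x C)"
      using expect_exp_blockage_step[OF C x J, of ?l] by (simp add: M_def)
    from mult_left_mono[OF this, of "M ^ s"] M(1)
    show "expect (dla_step n C) (\<lambda>C. M ^ s * exp (?l * low_blockage n J x C)) \<le> M ^ Suc s * exp (?l * low_blockage n J x C)"
      by (simp add: mult_ac)
  qed auto
  moreover have "{v \<in> {{}}. x \<subset> v \<and> card v \<le> J} = {}" by auto
  hence "low_blockage n J x {{}} = 0" unfolding low_blockage_def by (metis sum.empty)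
  ultimately have e: "expect (dla_state n t) (\<lambda>C. exp (?l * low_blockage n J x C)) \<le> M ^ t"
    by (simp add: dla_state_eq_run)
  have "measure_pmf.prob (dla_state n t) {C. low_blockage n J x C \<ge> \<beta>}
     \<le> expect (dla_state n t) (\<lambda>C. exp (- ?l * \<beta>) * exp (?l * low_blockage n J x C))"
  proof (rule prob_le_expect)
    fix C assume "C \<in> {C. low_blockage n J x C \<ge> \<beta>}"
    hence "?l * \<beta> \<le> ?l * low_blockage n J x C" by (intro mult_left_mono) auto
    thus "1 \<le> exp (- ?l * \<beta>) * exp (?l * low_blockage n J x C)" by (simp add: exp_add[symmetric])
  qed auto
  also have "\<dots> = exp (- ?l * \<beta>) * expect (dla_state n t) (\<lambda>C. exp (?l * low_blockage n J x C))" by simp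
  also have "\<dots> \<le> exp (- ?l * \<beta>) * M ^ t" using e by (intro mult_left_mono) auto
  also have "\<dots> \<le> exp (- ?l * \<beta>) * exp (2 * ?l * ?S) ^ t"
    using M by (intro mult_left_mono power_mono) auto
  also have "\<dots> = exp (- ?l * (\<beta> - 2 * real t * ?S))"
    by (simp add: exp_of_nat_mult[symmetric] exp_add[symmetric] algebra_simps)
  finally show ?thesis .
qed

section \<open>Saturation of low levels\<close>

text \<open>Note the shift: the vertices range over level \<open>k\<close>, but it is level k - 1
  whose occupation is measured. Vacancies on level k are therefore studied under
  \<open>saturated n (Suc k)\<close>.\<close>

definition saturated :: "nat \<Rightarrow> nat \<Rightarrow> nat set set \<Rightarrow> bool" where
  "saturated n k C \<longleftrightarrow> (\<forall>y\<in>level n k. 20 * card {i\<in>y. y - {i} \<notin> C} \<le> k)"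

lemma finite_level_member: "y \<in> level n k \<Longrightarrow> finite y"
  unfolding level_def using finite_subset by blast

lemma saturated_mono:
  assumes "saturated n k C" "C \<subseteq> C'"
  shows "saturated n k C'"
  unfolding saturated_def
proof
  fix y assume y: "y \<in> level n k"
  have "card {i\<in>y. y - {i} \<notin> C'} \<le> card {i\<in>y. y - {i} \<notin> C}"
    using assms(2) finite_level_member[OF y] by (intro card_mono) auto
  moreover have "20 * card {i\<in>y. y - {i} \<notin> C} \<le> k" using assms(1) y by (auto simp: saturated_def)
  ultimately show "20 * card {i\<in>y. y - {i} \<notin> C'} \<le> k" by linarith
qed

lemma card_occupied_children:
  assumes "saturated n k C" "y \<in> level n k"
  shows "real (card {i\<in>y. y - {i} \<in> C}) \<ge> 19 / 20 * real k"
proof -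
  have "card {i\<in>y. y - {i} \<in> C} + card {i\<in>y. y - {i} \<notin> C} = card y"
    using finite_level_member[OF assms(2)] by (subst card_Un_disjoint[symmetric]) (auto intro: arg_cong[of _ _ card])
  moreover have "20 * card {i\<in>y. y - {i} \<notin> C} \<le> k" "card y = k"
    using assms by (auto simp: saturated_def level_def)
  ultimately show ?thesis by linarith
qed

lemma low_blockage_mono:
  assumes "cluster n C'" "C \<subseteq> C'"
  shows "low_blockage n J x C \<le> low_blockage n J x C'"
  unfolding low_blockage_def
proof (rule sum_mono2)
  show "finite {v \<in> C'. x \<subset> v \<and> card v \<le> J}"
    by (rule finite_subset[of _ "Pow {0..<n}"]) (use assms(1) in \<open>auto simp: cluster_def\<close>)
qed (use assms(2) in auto)

text \<open>In a state of \<open>B\<close> nothing lies above level \<open>J\<close>, so the low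
  blockage is the whole blockage, and every vertex of \<open>S\<close> is hit with probability at
  least (19/20 - 1/10)/(n choose k). Hence each step leaves \<open>B\<close> with probability at
  least 17/20 |S|/(n choose k).\<close>

lemma prob_vacant_le:
  assumes k: "0 < k" "k \<le> n" and S: "S \<subseteq> level n k" and J: "J < n"
    and C: "cluster n C" "saturated n k C"
  defines "B \<equiv> {C. S \<inter> C = {} \<and> (\<forall>x\<in>S. low_blockage n J x C \<le> 1 / 10) \<and> (\<forall>v\<in>C. card v \<le> J)}"
  shows "measure_pmf.prob (dla_run n s C) B
    \<le> (1 - 17 / 20 * real (card S) / real (n choose k)) ^ s"
proof -
  define q where "q = 1 - 17 / 20 * real (card S) / real (n choose k)"
  have N: "real (n choose k) > 0" using k by simp
  have fS: "finite S" using S finite_subset finite_level by blast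
  have "card S \<le> n choose k" using S card_mono[OF finite_level S] by (simp add: card_level)
  hence "real (card S) \<le> real (n choose k)" by simp
  hence q0: "q \<ge> 0" using N by (simp add: q_def field_simps)
  have "expect (dla_run n s C) (\<lambda>C. q ^ 0 * indicator B C) \<le> q ^ s * indicator B C"
  proof (rule expect_dla_run_le[where P = "saturated n k" and f = "\<lambda>s C. q ^ s * indicator B C"])
    fix s C assume sat: "saturated n k C" and C: "cluster n C"
    show "expect (dla_step n C) (\<lambda>C. q ^ s * indicator B C) \<le> q ^ Suc s * indicator B C"
    proof (cases "C \<in> B")
      case False
      \<comment> \<open>Clusters grow and \<open>low_blockage\<close> is monotone, so all three
        conditions in \<open>B\<close> are inherited by earlier states. Thus a run that has left
        \<open>B\<close> never returns, and the conditions need to be checked only at the final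
        time.\<close>
      have "C' \<notin> B" if "C' \<in> set_pmf (dla_step n C)" for C'
      proof
        assume B: "C' \<in> B"
        have sub: "C \<subseteq> C'" and C': "cluster n C'" using that C step_superset cluster_step by auto
        have "\<forall>x\<in>S. low_blockage n J x C \<le> 1 / 10"
        proof
          fix x assume "x \<in> S"
          hence "low_blockage n J x C' \<le> 1 / 10" using B by (auto simp: B_def)
          thus "low_blockage n J x C \<le> 1 / 10" using low_blockage_mono[OF C' sub, of J x] by linarith
        qed
        hence "C \<in> B" using B sub by (auto simp: B_def)
        thus False using False by simp
      qed
      hence "expect (dla_step n C) (\<lambda>C. q ^ s * indicator B C) \<le> expect (dla_step n C) (\<lambda>C. 0)"
        by (intro expect_mono) auto
      thus ?thesis using False by simp
    next
      case True
      hence top: "{0..<n} \<notin> C" using J by (fastforce simp: B_def)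
      let ?s = "pmf (site_pmf n C)"
      have sx: "?s x \<ge> 17 / 20 / real (n choose k)" if x: "x \<in> S" for x
      proof -
        have xl: "x \<in> level n k" using x S by auto
        hence x': "x \<subseteq> {0..<n}" "card x = k" "x \<noteq> {}" using k by (auto simp: level_def)
        have "{v \<in> C. x \<subset> v} = {v \<in> C. x \<subset> v \<and> card v \<le> J}" using True by (auto simp: B_def)
        hence "blockage n x C = low_blockage n J x C" by (simp add: blockage_def low_blockage_def)
        moreover have "low_blockage n J x C \<le> 1 / 10" "x \<notin> C" using True x by (auto simp: B_def)
        moreover have "real (card {i\<in>x. x - {i} \<in> C}) / real k \<ge> 19 / 20"
          using card_occupied_children[OF sat xl] k by (simp add: field_simps)
        ultimately have "17 / 20 / real (n choose k) \<le>
          (real (card {i\<in>x. x - {i} \<in> C}) / real (card x) - blockage n x C) / real (n choose card x)"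
          unfolding x'(2) by (intro divide_right_mono) auto
        also have "\<dots> \<le> ?s x" by (rule site_pmf_ge[OF C top]) (use x' \<open>x \<notin> C\<close> in auto)
        finally show ?thesis .
      qed
      have SP: "S \<subseteq> Pow {0..<n}" using S by (auto simp: level_def)
      have "(\<Sum>v\<in>Pow {0..<n}. indicator B (insert v C) * ?s v) \<le> (\<Sum>v\<in>Pow {0..<n} - S. ?s v)"
      proof -
        have "(\<Sum>v\<in>Pow {0..<n}. indicator B (insert v C) * ?s v)
          = (\<Sum>v\<in>Pow {0..<n} - S. indicator B (insert v C) * ?s v)"
          by (rule sum.mono_neutral_right) (use SP in \<open>auto simp: B_def indicator_def\<close>)
        also have "\<dots> \<le> (\<Sum>v\<in>Pow {0..<n} - S. ?s v)"
          by (intro sum_mono) (auto simp: indicator_def)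
        finally show ?thesis .
      qed
      also have "\<dots> = 1 - (\<Sum>v\<in>S. ?s v)"
        using SP by (subst sum_diff) (auto simp: sum_site_pmf)
      also have "(\<Sum>v\<in>S. ?s v) \<ge> (\<Sum>v\<in>S. 17 / 20 / real (n choose k))"
        by (rule sum_mono) (use sx in auto)
      hence "1 - (\<Sum>v\<in>S. ?s v) \<le> q" by (simp add: q_def)
      finally have "(\<Sum>v\<in>Pow {0..<n}. indicator B (insert v C) * ?s v) \<le> q" .
      from mult_left_mono[OF this, of "q ^ s"] q0 show ?thesis
        unfolding expect_dla_step[OF top] mult.assoc sum_distrib_left[symmetric]
        using True by (simp add: mult.commute)
    qed
  qed (use C saturated_mono step_superset in blast)+
  also have "\<dots> \<le> q ^ s" using q0 by (simp add: indicator_def)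
  finally show ?thesis by (simp add: q_def)
qed

section \<open>Vacant vertices at an early time\<close>

lemma exp_le_quadratic:
  fixes z :: real
  assumes "0 \<le> z" "z \<le> 1"
  shows "exp z - 1 \<le> z + z\<^sup>2"
  using exp_bound[OF assms] by simp

text \<open>Each vacant vertex of the level is lost with probability at most 1/(n choose k), which
  gives the factor on the count. A step loses at most one vertex, so the second-order error is at
  most \<open>\<nu>\<close> squared.\<close>

lemma expect_exp_vacant_step:
  assumes C: "cluster n C" and k: "k \<le> n" and mu: "0 \<le> \<nu>" "\<nu> \<le> 1"
  shows "expect (dla_step n C) (\<lambda>C. exp (- \<nu> * real (card (level n k - C))))
    \<le> exp (- \<nu> * (1 - 1 / real (n choose k)) * real (card (level n k - C)) + \<nu>\<^sup>2)"
    (is "expect _ ?F \<le> ?R")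
proof (rule expect_step_le[OF C])
  define N where "N = real (n choose k)"
  have N: "N > 0" using k by (simp add: N_def)
  define u where "u = real (card (level n k - C))"
  have "card (level n k - C) \<le> n choose k" by (metis card_level card_mono Diff_subset finite_level)
  hence u: "0 \<le> u" "u \<le> N" by (auto simp: u_def N_def)
  have R: "?R = exp (- \<nu> * u + (\<nu> * (u / N) + \<nu>\<^sup>2))"
    by (simp add: N_def[symmetric] u_def[symmetric] algebra_simps)
  have "exp (- \<nu> * u) \<le> exp (- \<nu> * u + (\<nu> * (u / N) + \<nu>\<^sup>2))" using mu u N by simp
  thus "?F C \<le> ?R" unfolding R by (simp add: u_def)
  assume top: "{0..<n} \<notin> C"
  let ?s = "pmf (site_pmf n C)"
  let ?V = "level n k - C"
  have VP: "?V \<subseteq> Pow {0..<n}" by (auto simp: level_def)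
  have upd: "?F (insert v C) = exp (- \<nu> * u) * (1 + (exp \<nu> - 1) * indicator ?V v)" for v
  proof (cases "v \<in> ?V")
    case True
    have "level n k - insert v C = ?V - {v}" by auto
    moreover have "card ?V > 0" using True by (auto simp: card_gt_0_iff)
    ultimately have "real (card (level n k - insert v C)) = u - 1"
      using True by (simp add: u_def of_nat_diff)
    hence "?F (insert v C) = exp (- \<nu> * u) * exp \<nu>"
      by (simp add: right_diff_distrib exp_add[symmetric])
    thus ?thesis using True by simp
  next
    case False
    hence "level n k - insert v C = ?V" by auto
    thus ?thesis using False by (simp add: u_def)
  qed
  have "(\<Sum>v\<in>Pow {0..<n}. ?F (insert v C) * ?s v)
    = (\<Sum>v\<in>Pow {0..<n}. exp (- \<nu> * u) * (?s v + (exp \<nu> - 1) * (indicator ?V v * ?s v)))"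
    unfolding upd by (intro sum.cong) (auto simp: algebra_simps)
  also have "\<dots> = exp (- \<nu> * u) * ((\<Sum>v\<in>Pow {0..<n}. ?s v) + (exp \<nu> - 1) * (\<Sum>v\<in>Pow {0..<n}. indicator ?V v * ?s v))"
    by (simp only: sum_distrib_left[symmetric] sum.distrib)
  also have "(\<Sum>v\<in>Pow {0..<n}. indicator ?V v * ?s v) = (\<Sum>v\<in>?V. ?s v)"
    using VP by (intro sum.mono_neutral_cong_right) (auto simp: indicator_def)
  also have "exp (- \<nu> * u) * ((\<Sum>v\<in>Pow {0..<n}. ?s v) + (exp \<nu> - 1) * (\<Sum>v\<in>?V. ?s v))
    \<le> exp (- \<nu> * u) * (1 + (\<nu> + \<nu>\<^sup>2) * (u / N))"
  proof (intro mult_left_mono add_mono mult_mono)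
    have "(\<Sum>v\<in>?V. ?s v) \<le> (\<Sum>v\<in>?V. 1 / N)"
    proof (rule sum_mono)
      fix v assume "v \<in> ?V"
      thus "?s v \<le> 1 / N" using site_pmf_le[OF C top, of v] by (auto simp: level_def N_def)
    qed
    thus "(\<Sum>v\<in>?V. ?s v) \<le> u / N" by (simp add: u_def)
  qed (use mu exp_le_quadratic[OF mu] in \<open>auto simp: sum_site_pmf sum_nonneg\<close>)
  also have "\<dots> \<le> exp (- \<nu> * u) * (1 + (\<nu> * (u / N) + \<nu>\<^sup>2))"
  proof -
    have "\<nu>\<^sup>2 * (u / N) \<le> \<nu>\<^sup>2 * 1" using u N by (intro mult_left_mono) auto
    thus ?thesis by (intro mult_left_mono) (auto simp: algebra_simps)
  qed
  also have "\<dots> \<le> exp (- \<nu> * u) * exp (\<nu> * (u / N) + \<nu>\<^sup>2)"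
    by (intro mult_left_mono exp_ge_add_one_self) auto
  also have "\<dots> = ?R" unfolding R by (simp add: exp_add[symmetric])
  finally show "(\<Sum>v\<in>Pow {0..<n}. ?F (insert v C) * ?s v) \<le> ?R" .
qed

lemma prob_few_vacant_early:
  fixes n k t :: nat
  assumes k: "0 < k" "k \<le> n" and mu: "0 \<le> \<mu>" "\<mu> \<le> 1"
  defines "g \<equiv> (1 - 1 / real (n choose k)) ^ t * real (n choose k)"
  shows "measure_pmf.prob (dla_state n t) {C. real (card (level n k - C)) \<le> g / 2}
    \<le> exp (- \<mu> * g / 2 + real t * \<mu>\<^sup>2)"
proof -
  define r where "r = 1 - 1 / real (n choose k)"
  have "0 < n choose k" using k by simp
  hence "real (n choose k) \<ge> 1" by linarith
  hence "1 / real (n choose k) \<le> 1" using k by (subst divide_le_eq_1_pos) auto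
  hence r: "0 \<le> r" "r \<le> 1" by (auto simp: r_def)
  define u where "u C = real (card (level n k - C))" for C
  \<comment> \<open>A step multiplies the coefficient of the vacancy count by \<open>r\<close>.
    Starting with \<open>\<mu> * r ^ s\<close> when \<open>s\<close> steps remain, and paying
    \<open>\<mu>\<close> squared per step, makes the potential telescope.\<close>
  define f where "f s C = exp (- (\<mu> * r ^ s) * u C + real s * \<mu>\<^sup>2)" for s C
  have "expect (dla_run n t {{}}) (f 0) \<le> f t {{}}"
  proof (rule expect_dla_run_le[where P = "\<lambda>_. True"])
    fix s C assume C: "cluster n C"
    define \<nu> where "\<nu> = \<mu> * r ^ s"
    have rs: "0 \<le> r ^ s" "r ^ s \<le> 1" using r by (auto simp: power_le_one)
    have nu: "0 \<le> \<nu>" "\<nu> \<le> \<mu>" "\<nu> \<le> 1"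
      using rs mu mult_left_le[of "r ^ s" \<mu>] by (auto simp: \<nu>_def)
    have "f s = (\<lambda>C. exp (real s * \<mu>\<^sup>2) * exp (- \<nu> * real (card (level n k - C))))"
      by (auto simp: f_def \<nu>_def u_def exp_add[symmetric] fun_eq_iff)
    hence "expect (dla_step n C) (f s) = exp (real s * \<mu>\<^sup>2) * expect (dla_step n C) (\<lambda>C. exp (- \<nu> * real (card (level n k - C))))"
      by simp
    also have "\<dots> \<le> exp (real s * \<mu>\<^sup>2) * exp (- \<nu> * r * u C + \<nu>\<^sup>2)"
      using expect_exp_vacant_step[OF C k(2) nu(1,3)] unfolding r_def u_def by (intro mult_left_mono) auto
    also have "\<dots> \<le> exp (real s * \<mu>\<^sup>2) * exp (- \<nu> * r * u C + \<mu>\<^sup>2)"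
      using nu by (intro mult_left_mono) (auto intro: power_mono)
    also have "\<dots> = f (Suc s) C" by (simp add: f_def \<nu>_def exp_add[symmetric] algebra_simps)
    finally show "expect (dla_step n C) (f s) \<le> f (Suc s) C" .
  qed auto
  moreover have "level n k - {{}} = level n k" using k by (auto simp: level_def)
  hence "u {{}} = real (n choose k)" by (simp add: u_def card_level)
  ultimately have e: "expect (dla_state n t) (f 0) \<le> exp (- \<mu> * g + real t * \<mu>\<^sup>2)"
    by (simp add: dla_state_eq_run f_def g_def r_def mult_ac)
  have "measure_pmf.prob (dla_state n t) {C. u C \<le> g / 2} \<le> expect (dla_state n t) (\<lambda>C. exp (\<mu> * g / 2) * f 0 C)"
  proof (rule prob_le_expect)
    fix C assume "C \<in> {C. u C \<le> g / 2}"
    hence "\<mu> * u C \<le> \<mu> * (g / 2)" using mu by (intro mult_left_mono) auto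
    thus "1 \<le> exp (\<mu> * g / 2) * f 0 C" by (simp add: f_def exp_add[symmetric])
  qed (auto simp: f_def)
  also have "\<dots> = exp (\<mu> * g / 2) * expect (dla_state n t) (f 0)" by simp
  also have "\<dots> \<le> exp (\<mu> * g / 2) * exp (- \<mu> * g + real t * \<mu>\<^sup>2)" using e by (intro mult_left_mono) auto
  also have "\<dots> = exp (- \<mu> * g / 2 + real t * \<mu>\<^sup>2)" by (simp add: exp_add[symmetric])
  finally show ?thesis by (simp add: u_def)
qed

section \<open>Vacant vertices after saturation\<close>

text \<open>The growth factor \<open>1 / decay k\<close> compensates, at a vertex \<open>y\<close> with at least \<open>19/20\<close> of its
  \<open>k + 1\<close> children occupied, the chance \<open>1 / (k + 1)\<close> of losing a given vacant child.\<close>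

definition decay :: "nat \<Rightarrow> real" where
  "decay k = 1 / (1 + 20 / (19 * real (Suc k)))"

definition vacancy_weight :: "nat \<Rightarrow> nat \<Rightarrow> nat set set \<Rightarrow> nat set \<Rightarrow> real" where
  "vacancy_weight n k C x = decay k ^ card {i\<in>{0..<n} - x. insert i x \<notin> C}"

definition potential :: "nat \<Rightarrow> nat \<Rightarrow> nat set set \<Rightarrow> real" where
  "potential n k C = (\<Sum>x\<in>level n k - C. vacancy_weight n k C x)"

lemma decay_bounds: "0 < decay k" "decay k \<le> 1"
  by (auto simp: decay_def field_simps add_pos_pos)

lemma vacancy_weight_bounds: "0 < vacancy_weight n k C x" "vacancy_weight n k C x \<le> 1"
  using decay_bounds[of k] by (auto simp: vacancy_weight_def power_le_one)

definition potential_gain :: "nat \<Rightarrow> nat \<Rightarrow> nat set set \<Rightarrow> nat set \<Rightarrow> real" where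
  "potential_gain n k C v =
    (if v \<in> C then 0
     else if v \<in> level n k then - vacancy_weight n k C v
     else if v \<in> level n (Suc k)
       then 20 / (19 * real (Suc k)) * (\<Sum>i\<in>{i\<in>v. v - {i} \<notin> C}. vacancy_weight n k C (v - {i}))
     else 0)"

text \<open>Occupying a vertex of level k removes its own weight. Occupying one of level k + 1
  removes one vacant parent from exactly its vacant children and so divides their weights by
  \<open>decay k\<close>, that is, adds the fraction 20/(19(k + 1)). All other levels leave the
  weights alone.\<close>

lemma potential_insert: "potential n k (insert v C) = potential n k C + potential_gain n k C v"
proof (cases "v \<in> C")
  case True
  thus ?thesis by (simp add: potential_gain_def insert_absorb)
next
  case nC: False
  let ?w = "vacancy_weight n k C" and ?w' = "vacancy_weight n k (insert v C)"
  have card_ins: "card (insert i x) = Suc k" if "x \<in> level n k" "i \<in> {0..<n} - x" for i x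
    using that finite_level_member[OF that(1)] by (simp add: level_def)
  consider (low) "v \<in> level n k" | (up) "v \<notin> level n k" "v \<in> level n (Suc k)"
    | (other) "v \<notin> level n k" "v \<notin> level n (Suc k)" by blast
  thus ?thesis
  proof cases
    case low
    have "?w' x = ?w x" if "x \<in> level n k" for x
    proof -
      have "insert i x \<noteq> v" if "i \<in> {0..<n} - x" for i
        using card_ins[OF \<open>x \<in> level n k\<close> that] low by (auto simp: level_def)
      hence "{i\<in>{0..<n} - x. insert i x \<notin> insert v C} = {i\<in>{0..<n} - x. insert i x \<notin> C}" by blast
      thus ?thesis by (simp add: vacancy_weight_def)
    qed
    hence "potential n k (insert v C) = (\<Sum>x\<in>level n k - insert v C. ?w x)"
      unfolding potential_def by (intro sum.cong) auto
    also have "level n k - insert v C = (level n k - C) - {v}" by auto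
    also have "(\<Sum>x\<in>\<dots>. ?w x) = potential n k C - ?w v"
      using low nC by (subst sum_diff1) (auto simp: potential_def)
    finally show ?thesis using low nC by (simp add: potential_gain_def)
  next
    case up
    let ?b = "20 / (19 * real (Suc k))"
    have w': "?w' x = ?w x + (if x \<subset> v then ?b * ?w x else 0)" if x: "x \<in> level n k" for x
    proof (cases "x \<subset> v")
      case True
      have fin: "finite x" "finite v" using x up finite_level_member by auto
      have "card (v - x) = 1" using True up x fin by (auto simp: level_def card_Diff_subset)
      then obtain i where "v - x = {i}" by (auto simp: card_1_singleton_iff)
      hence i: "v = insert i x" "i \<notin> x" using True by auto
      have iN: "i \<in> {0..<n}" using up i by (auto simp: level_def)
      let ?A = "{i\<in>{0..<n} - x. insert i x \<notin> C}"
      have "{j\<in>{0..<n} - x. insert j x \<notin> insert v C} = ?A - {i}" using i by auto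
      moreover have iA: "i \<in> ?A" using i iN nC by auto
      ultimately have c: "card ?A = Suc (card {j\<in>{0..<n} - x. insert j x \<notin> insert v C})"
        by (metis (no_types, lifting) card_Suc_Diff1 finite_Diff finite_atLeastLessThan finite_subset mem_Collect_eq subsetI)
      have "?w x = decay k * ?w' x" unfolding vacancy_weight_def c by (rule power_Suc)
      hence "?w' x = ?w x / decay k" using decay_bounds[of k] by simp
      thus ?thesis using True by (simp add: decay_def algebra_simps)
    next
      case False
      have "insert i x \<noteq> v" if "i \<in> {0..<n} - x" for i using False that by blast
      hence "{i\<in>{0..<n} - x. insert i x \<notin> insert v C} = {i\<in>{0..<n} - x. insert i x \<notin> C}" by blast
      thus ?thesis using False by (simp add: vacancy_weight_def)
    qed
    have "level n k - insert v C = level n k - C" using up by auto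
    hence "potential n k (insert v C) = (\<Sum>x\<in>level n k - C. ?w x + (if x \<subset> v then ?b * ?w x else 0))"
      unfolding potential_def using w' by (intro sum.cong) auto
    also have "\<dots> = potential n k C + (\<Sum>x\<in>level n k - C. if x \<subset> v then ?b * ?w x else 0)"
      by (simp add: sum.distrib potential_def)
    also have "(\<Sum>x\<in>level n k - C. if x \<subset> v then ?b * ?w x else 0) = (\<Sum>x\<in>{x\<in>level n k - C. x \<subset> v}. ?b * ?w x)"
      by (rule sum.inter_filter[symmetric]) simp
    also have "\<dots> = (\<Sum>i\<in>{i\<in>v. v - {i} \<notin> C}. ?b * ?w (v - {i}))"
    proof (rule sym, rule sum.reindex_bij_betw[of "\<lambda>i. v - {i}"])
      have fv: "finite v" using up finite_level_member by auto
      show "bij_betw (\<lambda>i. v - {i}) {i\<in>v. v - {i} \<notin> C} {x\<in>level n k - C. x \<subset> v}"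
      proof (rule bij_betw_imageI)
        show "inj_on (\<lambda>i. v - {i}) {i\<in>v. v - {i} \<notin> C}" by (auto simp: inj_on_def)
        show "(\<lambda>i. v - {i}) ` {i\<in>v. v - {i} \<notin> C} = {x\<in>level n k - C. x \<subset> v}"
        proof
          show "(\<lambda>i. v - {i}) ` {i\<in>v. v - {i} \<notin> C} \<subseteq> {x\<in>level n k - C. x \<subset> v}"
            using up fv by (auto simp: level_def)
          show "{x\<in>level n k - C. x \<subset> v} \<subseteq> (\<lambda>i. v - {i}) ` {i\<in>v. v - {i} \<notin> C}"
          proof
            fix x assume x: "x \<in> {x\<in>level n k - C. x \<subset> v}"
            hence "card (v - x) = 1" using up fv finite_subset[of x v] by (auto simp: level_def card_Diff_subset)
            then obtain i where "v - x = {i}" by (auto simp: card_1_singleton_iff)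
            hence "x = v - {i}" "i \<in> v" using x by auto
            thus "x \<in> (\<lambda>i. v - {i}) ` {i\<in>v. v - {i} \<notin> C}" using x by auto
          qed
        qed
      qed
    qed
    finally show ?thesis using up nC by (simp add: potential_gain_def sum_distrib_left)
  next
    case other
    have "?w' x = ?w x" if "x \<in> level n k" for x
    proof -
      have "insert i x \<noteq> v" if i: "i \<in> {0..<n} - x" for i
        using card_ins[OF \<open>x \<in> level n k\<close> i] other \<open>x \<in> level n k\<close> i by (auto simp: level_def)
      hence "{i\<in>{0..<n} - x. insert i x \<notin> insert v C} = {i\<in>{0..<n} - x. insert i x \<notin> C}" by blast
      thus ?thesis by (simp add: vacancy_weight_def)
    qed
    moreover have "level n k - insert v C = level n k - C" using other by auto
    ultimately have "potential n k (insert v C) = potential n k C"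
      unfolding potential_def by (intro sum.cong) auto
    thus ?thesis using other by (simp add: potential_gain_def)
  qed
qed

text \<open>At most k + 1 children gain, each of weight at most 1, so the total gain is at most
  20/19.\<close>

lemma abs_potential_gain_le: "\<bar>potential_gain n k C v\<bar> \<le> 2"
proof -
  have "\<bar>20 / (19 * real (Suc k)) * (\<Sum>i\<in>{i\<in>v. v - {i} \<notin> C}. vacancy_weight n k C (v - {i}))\<bar> \<le> 2"
    if "v \<in> level n (Suc k)"
  proof -
    let ?S = "\<Sum>i\<in>{i\<in>v. v - {i} \<notin> C}. vacancy_weight n k C (v - {i})"
    have fv: "finite v" using that finite_level_member by auto
    have "?S \<le> (\<Sum>i\<in>{i\<in>v. v - {i} \<notin> C}. 1)" by (intro sum_mono vacancy_weight_bounds)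
    also have "\<dots> = real (card {i\<in>v. v - {i} \<notin> C})" by simp
    also have "\<dots> \<le> real (card v)" using fv by (intro of_nat_mono card_mono) auto
    finally have S: "?S \<le> real (Suc k)" using that by (simp add: level_def)
    have S0: "0 \<le> ?S" by (intro sum_nonneg) (auto intro: less_imp_le vacancy_weight_bounds)
    have "20 / (19 * real (Suc k)) * ?S \<le> 20 / (19 * real (Suc k)) * real (Suc k)"
      using S by (intro mult_left_mono) auto
    also have "\<dots> \<le> 2" by (simp del: of_nat_Suc)
    finally show ?thesis using S0 by (subst abs_of_nonneg) auto
  qed
  thus ?thesis using vacancy_weight_bounds[of n k C v] by (auto simp: potential_gain_def)
qed

text \<open>Loss and gain are compared edge by edge over pairs of a vacant \<open>x\<close> in level
  k and a vacant parent \<open>y\<close>. Along such an edge the loss is at most the weight of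
  \<open>x\<close> times the free step probability, and the gain is at least that, by saturation of
  \<open>y\<close>.\<close>

lemma potential_drift:
  assumes C: "cluster n C" "saturated n (Suc k) C" and top: "{0..<n} \<notin> C" and k: "0 < k" "k < n"
  shows "(\<Sum>v\<in>Pow {0..<n}. potential_gain n k C v * pmf (site_pmf n C) v) \<ge> 0"
proof -
  let ?s = "pmf (site_pmf n C)" and ?w = "vacancy_weight n k C" and ?F = "free_step_prob n C"
  let ?L = "level n k - C" and ?U = "level n (Suc k) - C"
  let ?ch = "\<lambda>y. {i\<in>y. y - {i} \<notin> C}" and ?up = "\<lambda>x. {i\<in>{0..<n} - x. insert i x \<notin> C}"
  let ?g = "potential_gain n k C"
  have dis: "level n k \<inter> level n (Suc k) = {}" by (auto simp: level_def)
  have "(\<Sum>v\<in>Pow {0..<n}. ?g v * ?s v) = (\<Sum>v\<in>?L \<union> ?U. ?g v * ?s v)"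
    by (rule sum.mono_neutral_right) (auto simp: potential_gain_def level_def)
  also have "\<dots> = (\<Sum>x\<in>?L. ?g x * ?s x) + (\<Sum>y\<in>?U. ?g y * ?s y)"
    using dis by (intro sum.union_disjoint) auto
  finally have split: "(\<Sum>v\<in>Pow {0..<n}. ?g v * ?s v)
    = (\<Sum>x\<in>?L. ?g x * ?s x) + (\<Sum>y\<in>?U. ?g y * ?s y)" .
  have lower: "(\<Sum>x\<in>?L. ?g x * ?s x) + (\<Sum>y\<in>?U. ?g y * ?s y) \<ge> - (\<Sum>x\<in>?L. \<Sum>i\<in>?up x. ?w x * ?F (insert i x) i) + (\<Sum>y\<in>?U. \<Sum>i\<in>?ch y. ?w (y - {i}) * ?F y i)"
  proof (rule add_mono)
    show "- (\<Sum>x\<in>?L. \<Sum>i\<in>?up x. ?w x * ?F (insert i x) i) \<le> (\<Sum>x\<in>?L. ?g x * ?s x)"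
      unfolding sum_negf[symmetric]
    proof (rule sum_mono)
      fix x assume x: "x \<in> ?L"
      have "card x < card {0..<n}" "x \<subseteq> {0..<n}" using x k by (auto simp: level_def)
      hence "x \<subset> {0..<n}" by auto
      moreover have "x \<noteq> {}" using x k by (auto simp: level_def)
      ultimately have "?s x \<le> (\<Sum>i\<in>?up x. ?F (insert i x) i)"
        using site_pmf_le_free_steps[OF C(1) top] by blast
      from mult_left_mono[OF this less_imp_le[OF vacancy_weight_bounds(1)], of n k C x]
      show "(\<Sum>i\<in>?up x. - (?w x * ?F (insert i x) i)) \<le> ?g x * ?s x"
        using x by (simp add: potential_gain_def sum_distrib_left sum_negf)
    qed
    show "(\<Sum>y\<in>?U. \<Sum>i\<in>?ch y. ?w (y - {i}) * ?F y i) \<le> (\<Sum>y\<in>?U. ?g y * ?s y)"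
    proof (rule sum_mono)
      fix y assume y: "y \<in> ?U"
      have yn: "y \<subseteq> {0..<n}" using y by (auto simp: level_def)
      let ?b = "20 / (19 * real (Suc k))"
      have "real (card {j\<in>y. y - {j} \<in> C}) \<ge> 19 / 20 * real (Suc k)"
        using card_occupied_children[OF C(2)] y by auto
      \<comment> \<open>The constant in \<open>decay\<close> is chosen for this: it is the
        reciprocal of the guaranteed number 19/20 (k + 1) of occupied children.\<close>
      from mult_left_mono[OF this, of ?b] have occ: "1 \<le> ?b * real (card {j\<in>y. y - {j} \<in> C})"
        by (simp del: of_nat_Suc)
      have "(\<Sum>i\<in>?ch y. ?w (y - {i}) * ?F y i) \<le> (\<Sum>i\<in>?ch y. ?b * ?w (y - {i}) * ?s y)"
      proof (rule sum_mono)
        fix i assume i: "i \<in> ?ch y"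
        have s: "?s y = real (card {j\<in>y. y - {j} \<in> C}) * ?F y i"
          using site_pmf_eq_free_step[OF C(1) top yn] i by auto
        have nn: "0 \<le> ?w (y - {i}) * ?F y i"
          using vacancy_weight_bounds(1)[of n k C "y - {i}"] by (simp add: free_step_prob_def less_imp_le)
        show "?w (y - {i}) * ?F y i \<le> ?b * ?w (y - {i}) * ?s y"
          using mult_right_mono[OF occ nn] unfolding s by (simp add: mult_ac)
      qed
      also have "\<dots> = ?b * (\<Sum>i\<in>?ch y. ?w (y - {i})) * ?s y"
        by (simp add: sum_distrib_left sum_distrib_right)
      also have "\<dots> = ?g y * ?s y"
        using y dis by (auto simp: potential_gain_def)
      finally show "(\<Sum>i\<in>?ch y. ?w (y - {i}) * ?F y i) \<le> ?g y * ?s y" .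
    qed
  qed
  \<comment> \<open>Both sums run over the same vacant edges, listed by the upper endpoint on one
    side and by the lower endpoint on the other.\<close>
  have "(\<Sum>y\<in>?U. \<Sum>i\<in>?ch y. ?w (y - {i}) * ?F y i) = (\<Sum>x\<in>?L. \<Sum>i\<in>?up x. ?w x * ?F (insert i x) i)"
  proof -
    have fin: "finite (?ch y)" if "y \<in> ?U" for y using that finite_level_member by auto
    have "(\<Sum>y\<in>?U. \<Sum>i\<in>?ch y. ?w (y - {i}) * ?F y i) = (\<Sum>(y,i)\<in>Sigma ?U ?ch. ?w (y - {i}) * ?F y i)"
      by (rule sum.Sigma) (use fin in auto)
    also have "\<dots> = (\<Sum>(x,i)\<in>Sigma ?L ?up. ?w x * ?F (insert i x) i)"
    proof (rule sum.reindex_bij_witness[where i = "\<lambda>(x,i). (insert i x, i)" and j = "\<lambda>(y,i). (y - {i}, i)"])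
      fix a assume a: "a \<in> Sigma ?U ?ch"
      obtain y i where yi: "a = (y, i)" by (cases a)
      have y: "y \<in> ?U" "i \<in> y" "y - {i} \<notin> C" using a yi by auto
      have ins: "insert i (y - {i}) = y" using y by auto
      show "(case (case a of (y, i) \<Rightarrow> (y - {i}, i)) of (x, i) \<Rightarrow> (insert i x, i)) = a"
        using yi ins by simp
      show "(case a of (y, i) \<Rightarrow> (y - {i}, i)) \<in> Sigma ?L ?up"
        using yi y ins finite_level_member[of y n "Suc k"] by (auto simp: level_def)
      show "(case (case a of (y, i) \<Rightarrow> (y - {i}, i)) of (x, i) \<Rightarrow> ?w x * ?F (insert i x) i)
          = (case a of (y, i) \<Rightarrow> ?w (y - {i}) * ?F y i)"
        using yi ins by simp
    next
      fix b assume b: "b \<in> Sigma ?L ?up"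
      obtain x i where xi: "b = (x, i)" by (cases b)
      have x: "x \<in> ?L" "i \<in> {0..<n}" "i \<notin> x" "insert i x \<notin> C" using b xi by auto
      have del: "insert i x - {i} = x" using x by auto
      show "(case (case b of (x, i) \<Rightarrow> (insert i x, i)) of (y, i) \<Rightarrow> (y - {i}, i)) = b"
        using xi del by simp
      show "(case b of (x, i) \<Rightarrow> (insert i x, i)) \<in> Sigma ?U ?ch"
        using xi x del finite_level_member[of x n k] by (auto simp: level_def)
    qed
    also have "\<dots> = (\<Sum>x\<in>?L. \<Sum>i\<in>?up x. ?w x * ?F (insert i x) i)"
      by (rule sum.Sigma[symmetric]) auto
    finally show ?thesis .
  qed
  thus ?thesis using split lower by linarith
qed

text \<open>Exponential supermartingale for the drift bound. The quadratic compensator is charged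
  only when a vertex is attached on level k or k + 1, so it totals at most the size of the two
  levels and the bound is uniform in the running time \<open>s\<close>.\<close>

lemma prob_few_vacant_final:
  assumes C: "cluster n C" "saturated n (Suc k) C" and k: "0 < k" "k < n"
    and mu: "0 \<le> \<mu>" "\<mu> \<le> 1 / 4" and h: "h \<le> decay k ^ (n - k) * real (card (level n k - C))"
  shows "measure_pmf.prob (dla_run n s C) {C'. real (card (level n k - C')) \<le> h / 2}
    \<le> exp (- \<mu> * h / 2 + 8 * \<mu>\<^sup>2 * real ((n choose k) + (n choose Suc k)))"
proof -
  let ?LL = "level n k \<union> level n (Suc k)"
  let ?M = "real ((n choose k) + (n choose Suc k))"
  define \<Psi> where "\<Psi> C = exp (- \<mu> * potential n k C - 8 * \<mu>\<^sup>2 * real (card (C \<inter> ?LL)))" for C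
  have upd: "\<Psi> (insert v C) \<le> \<Psi> C * (1 - \<mu> * potential_gain n k C v)" for v C
  proof (cases "v \<in> C \<or> v \<notin> ?LL")
    case True
    hence "potential_gain n k C v = 0" "insert v C \<inter> ?LL = C \<inter> ?LL" by (auto simp: potential_gain_def)
    thus ?thesis by (simp add: \<Psi>_def potential_insert)
  next
    case False
    let ?z = "\<mu> * potential_gain n k C v"
    have z: "\<bar>?z\<bar> \<le> 2 * \<mu>"
      using abs_potential_gain_le[of n k C v] mu mult_left_mono[of "\<bar>potential_gain n k C v\<bar>" 2 \<mu>]
      by (simp add: abs_mult)
    hence z2: "\<bar>- ?z\<bar> \<le> 1 / 2" using mu by auto
    have "?z\<^sup>2 \<le> (2 * \<mu>)\<^sup>2" using z by (metis abs_ge_zero power2_abs power_mono)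
    \<comment> \<open>For |z| <= 1/2 one has ln(1 - z) >= -z - 2 z^2, and |z| <= 2
      \<open>\<mu>\<close> turns the last term into the compensator 8
      \<open>\<mu>\<close>^2.\<close>
    hence "- ?z - 8 * \<mu>\<^sup>2 \<le> ln (1 + - ?z)"
      using abs_ln_one_plus_x_minus_x_bound[OF z2] by (simp add: power_mult_distrib abs_le_iff)
    hence "exp (- ?z - 8 * \<mu>\<^sup>2) \<le> exp (ln (1 + - ?z))" by simp
    also have "\<dots> = 1 - ?z" using z2 by (subst exp_ln) (auto simp: abs_le_iff)
    finally have e: "exp (- ?z - 8 * \<mu>\<^sup>2) \<le> 1 - ?z" .
    have "insert v C \<inter> ?LL = insert v (C \<inter> ?LL)" using False by auto
    hence c: "card (insert v C \<inter> ?LL) = Suc (card (C \<inter> ?LL))" using False by simp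
    have "\<Psi> (insert v C) = \<Psi> C * exp (- ?z - 8 * \<mu>\<^sup>2)"
      unfolding \<Psi>_def c potential_insert by (simp add: exp_add[symmetric] algebra_simps)
    also have "\<dots> \<le> \<Psi> C * (1 - ?z)" using e by (intro mult_left_mono) (auto simp: \<Psi>_def)
    finally show ?thesis .
  qed
  have e: "expect (dla_run n s C) \<Psi> \<le> \<Psi> C"
  proof (rule expect_dla_run_le[where P = "saturated n (Suc k)" and f = "\<lambda>_. \<Psi>"])
    fix C assume sat: "saturated n (Suc k) C" and C: "cluster n C"
    show "expect (dla_step n C) \<Psi> \<le> \<Psi> C"
    proof (rule expect_step_le[OF C order_refl])
      assume top: "{0..<n} \<notin> C"
      let ?s = "pmf (site_pmf n C)" and ?g = "potential_gain n k C"
      have "(\<Sum>v\<in>Pow {0..<n}. \<Psi> (insert v C) * ?s v) \<le> (\<Sum>v\<in>Pow {0..<n}. \<Psi> C * (1 - \<mu> * ?g v) * ?s v)"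
        by (intro sum_mono mult_right_mono upd) auto
      also have "\<dots> = \<Psi> C * ((\<Sum>v\<in>Pow {0..<n}. ?s v) - \<mu> * (\<Sum>v\<in>Pow {0..<n}. ?g v * ?s v))"
        by (simp add: sum_distrib_left sum_subtractf[symmetric] algebra_simps)
      also have "\<dots> \<le> \<Psi> C * 1"
        using potential_drift[OF C sat top k] mu by (intro mult_left_mono) (auto simp: sum_site_pmf \<Psi>_def)
      finally show "(\<Sum>v\<in>Pow {0..<n}. \<Psi> (insert v C) * ?s v) \<le> \<Psi> C" by simp
    qed
  qed (use C saturated_mono step_superset in blast)+
  \<comment> \<open>A vertex of level k has n - k parents, so its weight lies between
    \<open>decay k ^ (n - k)\<close> and 1. The lower bound turns the initial number of vacancies
    into potential; the upper bound turns the final potential back into a number of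
    vacancies.\<close>
  have hC: "h \<le> potential n k C"
  proof -
    have "decay k ^ (n - k) \<le> vacancy_weight n k C x" if "x \<in> level n k - C" for x
    proof -
      have "card {i\<in>{0..<n} - x. insert i x \<notin> C} \<le> card ({0..<n} - x)" by (intro card_mono) auto
      also have "\<dots> = n - k"
        using that finite_level_member[of x n k] by (auto simp: level_def card_Diff_subset)
      finally show ?thesis unfolding vacancy_weight_def
        using decay_bounds[of k] by (intro power_decreasing) auto
    qed
    hence "(\<Sum>x\<in>level n k - C. decay k ^ (n - k)) \<le> potential n k C"
      unfolding potential_def by (intro sum_mono) auto
    thus ?thesis using h by (simp add: mult.commute)
  qed
  have "\<mu> * h \<le> \<mu> * potential n k C" using hC mu by (intro mult_left_mono) auto
  moreover have "0 \<le> 8 * \<mu>\<^sup>2 * real (card (C \<inter> ?LL))" by simp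
  ultimately have "- \<mu> * potential n k C - 8 * \<mu>\<^sup>2 * real (card (C \<inter> ?LL)) \<le> - \<mu> * h" by linarith
  hence \<Psi>C: "\<Psi> C \<le> exp (- \<mu> * h)" by (simp add: \<Psi>_def)
  have "measure_pmf.prob (dla_run n s C) {C'. real (card (level n k - C')) \<le> h / 2}
    \<le> expect (dla_run n s C) (\<lambda>C'. exp (\<mu> * h / 2 + 8 * \<mu>\<^sup>2 * ?M) * \<Psi> C')"
  proof (rule prob_le_expect)
    fix C' assume "C' \<in> {C'. real (card (level n k - C')) \<le> h / 2}"
    hence C': "real (card (level n k - C')) \<le> h / 2" by simp
    have "potential n k C' \<le> (\<Sum>x\<in>level n k - C'. 1)"
      unfolding potential_def by (intro sum_mono vacancy_weight_bounds)
    hence "potential n k C' \<le> h / 2" using C' by simp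
    hence 1: "\<mu> * potential n k C' \<le> \<mu> * (h / 2)" using mu by (intro mult_left_mono) auto
    have "card (C' \<inter> ?LL) \<le> card ?LL" by (intro card_mono) auto
    also have "\<dots> \<le> (n choose k) + (n choose Suc k)"
      using card_Un_le[of "level n k" "level n (Suc k)"] by (simp add: card_level)
    finally have "real (card (C' \<inter> ?LL)) \<le> ?M" by (rule of_nat_mono)
    hence "8 * \<mu>\<^sup>2 * real (card (C' \<inter> ?LL)) \<le> 8 * \<mu>\<^sup>2 * ?M" by (intro mult_left_mono) auto
    thus "1 \<le> exp (\<mu> * h / 2 + 8 * \<mu>\<^sup>2 * ?M) * \<Psi> C'"
      using 1 by (simp add: \<Psi>_def exp_add[symmetric])
  qed (auto simp: \<Psi>_def)
  also have "\<dots> = exp (\<mu> * h / 2 + 8 * \<mu>\<^sup>2 * ?M) * expect (dla_run n s C) \<Psi>" by simp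
  also have "\<dots> \<le> exp (\<mu> * h / 2 + 8 * \<mu>\<^sup>2 * ?M) * exp (- \<mu> * h)"
    using e \<Psi>C by (intro mult_left_mono) auto
  also have "\<dots> = exp (- \<mu> * h / 2 + 8 * \<mu>\<^sup>2 * ?M)" by (simp add: exp_add[symmetric])
  finally show ?thesis .
qed

section \<open>Binomial estimates\<close>

lemma Suc_times_choose_Suc: "Suc k * (n choose Suc k) = (n - k) * (n choose k)"
  by (simp only: binomial_absorption binomial_absorb_comp)

text \<open>The ratio of neighbouring levels is (n - j)/(j + 1). Growth by 3 up to level n/4 is the
  reason for the cutoff \<open>n div 4\<close>.\<close>

lemma choose_Suc_ge_three_times:
  assumes "4 * Suc j \<le> n"
  shows "3 * (n choose j) \<le> n choose Suc j"
proof -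
  have "Suc j * (3 * (n choose j)) = (3 * Suc j) * (n choose j)" by (simp add: algebra_simps)
  also have "\<dots> \<le> (n - j) * (n choose j)" using assms by (intro mult_right_mono) auto
  also have "\<dots> = Suc j * (n choose Suc j)" by (rule Suc_times_choose_Suc[symmetric])
  finally show ?thesis by (simp only: mult_le_cancel1)
qed

lemma choose_growth: "4 * (m + l) \<le> n \<Longrightarrow> 3 ^ l * (n choose m) \<le> n choose (m + l)"
proof (induction l)
  case (Suc l)
  have "3 ^ Suc l * (n choose m) = 3 * (3 ^ l * (n choose m))" by simp
  also have "\<dots> \<le> 3 * (n choose (m + l))" using Suc by (intro mult_left_mono) auto
  also have "\<dots> \<le> n choose Suc (m + l)" using Suc.prems by (intro choose_Suc_ge_three_times) auto
  finally show ?case by simp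
qed simp

lemma sum_inverse_choose_le:
  assumes "Suc k \<le> n"
  shows "(\<Sum>j\<in>{k<..n div 4}. 1 / real (n choose j)) \<le> 2 / real (n choose Suc k)"
proof -
  let ?N = "real (n choose Suc k)"
  have N: "?N > 0" using assms by simp
  have "(\<Sum>j\<in>{k<..n div 4}. 1 / real (n choose j)) \<le> (\<Sum>j\<in>{k<..n div 4}. (1 / 3) ^ (j - Suc k) / ?N)"
  proof (rule sum_mono)
    fix j assume j: "j \<in> {k<..n div 4}"
    define l where "l = j - Suc k"
    have jl: "j = Suc k + l" using j by (auto simp: l_def)
    have "3 ^ l * (n choose Suc k) \<le> n choose (Suc k + l)"
      by (rule choose_growth) (use j jl in auto)
    hence "real (3 ^ l * (n choose Suc k)) \<le> real (n choose j)" unfolding jl by (rule of_nat_mono)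
    hence "3 ^ l * ?N \<le> real (n choose j)" by simp
    hence "1 / real (n choose j) \<le> 1 / (3 ^ l * ?N)" using N j by (intro divide_left_mono mult_pos_pos) auto
    also have "\<dots> = (1 / 3) ^ l / ?N" by (simp add: power_one_over field_simps)
    finally show "1 / real (n choose j) \<le> (1 / 3) ^ (j - Suc k) / ?N" by (simp add: l_def)
  qed
  also have "\<dots> = (\<Sum>j\<in>{k<..n div 4}. (1 / 3) ^ (j - Suc k)) / ?N" by (simp add: sum_divide_distrib)
  also have "(\<Sum>j\<in>{k<..n div 4}. (1 / 3 :: real) ^ (j - Suc k)) \<le> (\<Sum>l<n. (1 / 3) ^ l)"
  proof -
    have inj: "inj_on (\<lambda>j. j - Suc k) {k<..n div 4}" by (auto simp: inj_on_def)
    have "(\<Sum>j\<in>{k<..n div 4}. (1 / 3 :: real) ^ (j - Suc k)) = (\<Sum>l\<in>(\<lambda>j. j - Suc k) ` {k<..n div 4}. (1 / 3) ^ l)"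
      by (simp add: sum.reindex[OF inj])
    also have "\<dots> \<le> (\<Sum>l<n. (1 / 3) ^ l)" using assms by (intro sum_mono2) auto
    finally show ?thesis .
  qed
  also have "(\<Sum>l<n. (1 / 3 :: real) ^ l) \<le> 2"
  proof -
    define c where "c = (1 / 3 :: real) ^ n"
    have "(\<Sum>l<n. (1 / 3 :: real) ^ l) = (c - 1) / (1 / 3 - 1)" unfolding c_def by (rule geometric_sum) simp
    moreover have "0 \<le> c" by (simp add: c_def)
    ultimately show ?thesis by (simp add: field_simps)
  qed
  finally show ?thesis using N by (simp add: divide_right_mono)
qed

lemma choose_times_power_le_exp:
  fixes q :: real
  assumes "0 \<le> q"
  shows "real (n choose m) * q ^ m \<le> exp (q * real n)"
proof (cases "m \<le> n")
  case True
  have "real (n choose m) * q ^ m \<le> (\<Sum>i\<le>n. real (n choose i) * q ^ i)"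
    using True assms by (intro member_le_sum) auto
  also have "\<dots> = (q + 1) ^ n" by (simp add: binomial_ring[of q 1 n])
  also have "\<dots> \<le> exp q ^ n" using assms exp_ge_add_one_self[of q] by (intro power_mono) (auto simp: add.commute)
  finally show ?thesis by (simp add: exp_of_nat_mult[symmetric] mult.commute)
qed (simp add: binomial_eq_0)

lemma exp_11_ge: "exp (11 :: real) \<ge> 20000"
proof -
  have "exp (1 :: real) \<ge> 5 / 2" using exp_lower_Taylor_quadratic[of 1] by simp
  hence "(5 / 2) ^ 11 \<le> exp (1 :: real) ^ 11" by (intro power_mono) auto
  also have "\<dots> = exp 11" by (simp add: exp_of_nat_mult[symmetric])
  finally show ?thesis by (simp add: power_divide)
qed

lemma choose_times_two_power_le:
  assumes "1000000 * k < n" "m \<le> Suc k"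
  shows "real (n choose m) * 2 ^ m \<le> exp (112 / 1000000 * real n + 11)"
proof -
  \<comment> \<open>Splitting 2 = 20000/10000 leaves one term of a binomial expansion, at most
    exp(n/10000), and a power of 20000 <= e^11 with exponent at most n/10^6 + 1. In total this gives
    100 + 11 <= 112 millionths of n.\<close>
  have "real (n choose m) * 2 ^ m = real (n choose m) * (1 / 10000) ^ m * 20000 ^ m"
    by (simp add: power_mult_distrib[symmetric])
  also have "\<dots> \<le> exp (1 / 10000 * real n) * exp 11 ^ m"
    using choose_times_power_le_exp[of "1 / 10000" n m] exp_11_ge by (intro mult_mono power_mono) auto
  also have "\<dots> = exp (1 / 10000 * real n + 11 * real m)"
    by (simp add: exp_of_nat_mult[symmetric] exp_add[symmetric] mult.commute)
  also have "\<dots> \<le> exp (112 / 1000000 * real n + 11)"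
  proof -
    have "1000000 * real k < real n" "real m \<le> real k + 1"
      using assms by (metis of_nat_less_iff of_nat_mult of_nat_numeral) (use assms in linarith)
    thus ?thesis by simp
  qed
  finally show ?thesis .
qed

section \<open>All low levels saturate in time\<close>

definition sat_time :: "nat \<Rightarrow> nat \<Rightarrow> nat" where
  "sat_time n k = (n choose Suc k) div 100"

lemma sat_time_le: "real (sat_time n k) \<le> real (n choose Suc k) / 100"
proof -
  have "sat_time n k * 100 \<le> n choose Suc k" by (simp add: sat_time_def)
  hence "real (sat_time n k * 100) \<le> real (n choose Suc k)" by (rule of_nat_mono)
  thus ?thesis by simp
qed

text \<open>Up to time T_k <= (n choose (k + 1)), the l-th level above k + 1 costs a factor at most
  3^(-l) <= e^(-l). The product over about n/4 levels decays like exp(-i^2/2) and outweighs the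
  trivial count 2^n.\<close>

lemma prob_high_level_occupied:
  assumes "1000000 \<le> n" "1000000 * k < n"
  shows "measure_pmf.prob (dla_state n (sat_time n k)) {C. C \<inter> level n (n div 4) \<noteq> {}} \<le> exp (- real n)"
proof -
  define i where "i = n div 4 - Suc k"
  have J: "n div 4 = Suc k + i" using assms by (auto simp: i_def)
  let ?T = "sat_time n k"
  have "measure_pmf.prob (dla_state n ?T) {C. C \<inter> level n (Suc k + i) \<noteq> {}}
     \<le> real ?T * (\<Prod>l<i. real ?T / real (n choose (Suc k + l)))"
    by (rule prob_level_occupied_le) auto
  also have "\<dots> \<le> 2 ^ n * (\<Prod>l<i. exp (- real l))"
  proof (intro mult_mono prod_mono conjI)
    have "?T \<le> n choose Suc k" by (simp add: sat_time_def)
    also have "\<dots> \<le> 2 ^ n" by (rule binomial_le_pow2)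
    finally show "real ?T \<le> 2 ^ n" by (metis of_nat_le_numeral_power_cancel_iff)
    fix l assume l: "l \<in> {..<i}"
    have "3 ^ l * (n choose Suc k) \<le> n choose (Suc k + l)"
      by (rule choose_growth) (use l J in auto)
    hence g: "real (3 ^ l * (n choose Suc k)) \<le> real (n choose (Suc k + l))" by (rule of_nat_mono)
    have N: "real (n choose Suc k) > 0" using assms by simp
    have "exp (real l) \<le> 3 ^ l"
      using power_mono[OF exp_le, of l] by (simp add: exp_of_nat_mult[symmetric])
    hence "exp (real l) * real ?T \<le> 3 ^ l * real (n choose Suc k)"
      using \<open>?T \<le> n choose Suc k\<close> by (intro mult_mono) auto
    hence "exp (real l) * real ?T \<le> real (n choose (Suc k + l))" using g by simp
    moreover have "real (n choose (Suc k + l)) > 0" using J l by simp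
    ultimately show "real ?T / real (n choose (Suc k + l)) \<le> exp (- real l)"
      by (simp add: exp_minus field_simps)
  qed (auto intro!: prod_nonneg)
  also have "(\<Prod>l<i. exp (- real l)) = exp (- (\<Sum>l<i. real l))"
    by (simp add: exp_sum[symmetric] sum_negf)
  also have "(2 :: real) ^ n \<le> exp (real n)"
    using exp_ge_add_one_self[of 1] power_mono[of 2 "exp 1 :: real" n] by (simp add: exp_of_nat_mult[symmetric])
  hence "2 ^ n * exp (- (\<Sum>l<i. real l)) \<le> exp (real n) * exp (- (\<Sum>l<i. real l))"
    by (intro mult_right_mono) auto
  also have "\<dots> = exp (real n - (\<Sum>l<i. real l))" by (simp add: exp_add[symmetric])
  also have "\<dots> \<le> exp (- real n)"
  proof -
    have s: "2 * (\<Sum>l<i. real l) = real i * (real i - 1)"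
      by (induction i) (auto simp: algebra_simps)
    \<comment> \<open>This makes i(i - 1) >= 4n, so the exponent sum is at least 2n: one n cancels
      the bound e^n on 2^n, the other remains.\<close>
    have "5 * i \<ge> n" using J assms by auto
    hence i5: "real i \<ge> real n / 5" by linarith
    have "real n \<ge> 1000000" using assms by simp
    hence "real n / 5 * 20 \<le> real i * (real i - 1)" using i5 by (intro mult_mono) auto
    thus ?thesis using s by simp
  qed
  finally show ?thesis unfolding J .
qed

text \<open>The drift uses up 4/100 of the threshold 1/10. The remaining 6/100 gives a failure rate
  of 6/100 (n - k), far above the 112/10^6 n needed for the union over level k.\<close>

lemma prob_some_blockage:
  assumes "1000000 \<le> n" "1000000 * k < n"
  shows "measure_pmf.prob (dla_state n (sat_time n k)) (\<Union>x\<in>level n k. {C. low_blockage n (n div 4) x C \<ge> 1 / 10})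
    \<le> exp (- real n / 20000)"
proof -
  let ?p = "dla_state n (sat_time n k)"
  have nk: "1000000 * real k < real n" "real n \<ge> 1000000"
    using assms by (metis of_nat_less_iff of_nat_mult of_nat_numeral) (use assms in linarith)
  have "measure_pmf.prob ?p (\<Union>x\<in>level n k. {C. low_blockage n (n div 4) x C \<ge> 1 / 10})
    \<le> (\<Sum>x\<in>level n k. measure_pmf.prob ?p {C. low_blockage n (n div 4) x C \<ge> 1 / 10})"
    by (rule measure_pmf.finite_measure_subadditive_finite) auto
  also have "\<dots> \<le> (\<Sum>x\<in>level n k. exp (- (real n - real k) * (6 / 100)))"
  proof (rule sum_mono)
    fix x assume x: "x \<in> level n k"
    let ?S = "\<Sum>j\<in>{k<..n div 4}. 1 / real (n choose j)"
    have N: "real (n choose Suc k) > 0" using assms by simp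
    have "2 * real (sat_time n k) * ?S \<le> 2 * (real (n choose Suc k) / 100) * (2 / real (n choose Suc k))"
      using sum_inverse_choose_le[of k n] sat_time_le[of n k] assms
      by (intro mult_mono) (auto intro!: sum_nonneg)
    also have "\<dots> = 4 / 100" using N by simp
    finally have S: "6 / 100 \<le> 1 / 10 - 2 * real (sat_time n k) * ?S" by simp
    have "measure_pmf.prob ?p {C. low_blockage n (n div 4) x C \<ge> 1 / 10}
      \<le> exp (- real (n - card x) * (1 / 10 - 2 * real (sat_time n k) * (\<Sum>j\<in>{card x<..n div 4}. 1 / real (n choose j))))"
      by (rule prob_low_blockage) (use x assms in \<open>auto simp: level_def\<close>)
    also have "card x = k" using x by (simp add: level_def)
    also have "exp (- real (n - k) * (1 / 10 - 2 * real (sat_time n k) * ?S)) \<le> exp (- (real n - real k) * (6 / 100))"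
    proof -
      have "real (n - k) = real n - real k" using assms by (simp add: of_nat_diff)
      moreover have "(real n - real k) * (6 / 100) \<le> (real n - real k) * (1 / 10 - 2 * real (sat_time n k) * ?S)"
        using S nk by (intro mult_left_mono) auto
      ultimately show ?thesis by (simp only: exp_le_cancel_iff minus_mult_left[symmetric] neg_le_iff_le)
    qed
    finally show "measure_pmf.prob ?p {C. low_blockage n (n div 4) x C \<ge> 1 / 10} \<le> exp (- (real n - real k) * (6 / 100))" .
  qed
  also have "\<dots> = real (n choose k) * exp (- (real n - real k) * (6 / 100))" by (simp add: card_level)
  also have "\<dots> \<le> exp (112 / 1000000 * real n + 11) * exp (- (real n - real k) * (6 / 100))"
  proof (rule mult_right_mono)
    have "real (n choose k) * 1 \<le> real (n choose k) * 2 ^ k" by (intro mult_left_mono) auto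
    also have "\<dots> \<le> exp (112 / 1000000 * real n + 11)" using assms by (intro choose_times_two_power_le[of k]) auto
    finally show "real (n choose k) \<le> exp (112 / 1000000 * real n + 11)" by simp
  qed simp
  also have "\<dots> \<le> exp (- real n / 20000)"
    unfolding exp_add[symmetric] exp_le_cancel_iff using nk by (simp add: field_simps)
  finally show ?thesis .
qed

text \<open>Base of the induction: the only child of a singleton is the bottom, which is always
  occupied.\<close>

lemma saturated_1: "cluster n C \<Longrightarrow> saturated n 1 C"
proof -
  assume C: "cluster n C"
  have "card {i\<in>y. y - {i} \<notin> C} = 0" if "y \<in> level n 1" for y
  proof -
    have "card y = 1" using that by (simp add: level_def)
    then obtain a where "y = {a}" by (rule card_1_singletonE)
    thus ?thesis using C by (auto simp: cluster_def)
  qed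
  thus ?thesis by (auto simp: saturated_def)
qed

lemma unsaturated_witness:
  assumes "\<not> saturated n (Suc k) C"
  obtains y S where "y \<in> level n (Suc k)" "S \<subseteq> (\<lambda>i. y - {i}) ` y" "Suc k < 20 * card S" "S \<inter> C = {}"
proof -
  obtain y where y: "y \<in> level n (Suc k)" "Suc k < 20 * card {i\<in>y. y - {i} \<notin> C}"
    using assms by (auto simp: saturated_def not_le)
  have "inj_on (\<lambda>i. y - {i}) {i\<in>y. y - {i} \<notin> C}" by (auto simp: inj_on_def)
  hence "card ((\<lambda>i. y - {i}) ` {i\<in>y. y - {i} \<notin> C}) = card {i\<in>y. y - {i} \<notin> C}" by (rule card_image)
  thus ?thesis using y by (intro that[of y "(\<lambda>i. y - {i}) ` {i\<in>y. y - {i} \<notin> C}"]) auto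
qed

text \<open>A set \<open>S\<close> of more than (k + 1)/20 children of \<open>y\<close> must survive
  at least (n choose (k + 1))/200 steps. Since (n choose (k + 1))/(n choose k) = (n - k)/(k + 1),
  the exponent becomes 17/80000 (n - k), with no division by k left. This is about 212/10^6 n,
  against 112/10^6 n for the number of pairs in \<open>I\<close>.\<close>

lemma prob_unsaturated_step:
  assumes n: "1000000 \<le> n" "1000000 * k < n" and k: "0 < k"
    and C: "cluster n C" "saturated n k C" and s: "s = sat_time n k - sat_time n (k - 1)"
  defines "B \<equiv> \<lambda>S. {C. S \<inter> C = {} \<and> (\<forall>x\<in>S. low_blockage n (n div 4) x C \<le> 1 / 10) \<and> (\<forall>v\<in>C. card v \<le> n div 4)}"
  defines "I \<equiv> SIGMA y:level n (Suc k). {S. S \<subseteq> (\<lambda>i. y - {i}) ` y \<and> Suc k < 20 * card S}"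
  shows "measure_pmf.prob (dla_run n s C) (\<Union>(y, S)\<in>I. B S) \<le> exp (- real n / 20000)"
proof -
  let ?N = "real (n choose k)" and ?N' = "real (n choose Suc k)"
  have nk: "1000000 * real k < real n" "real n \<ge> 1000000"
    using n by (metis of_nat_less_iff of_nat_mult of_nat_numeral) (use n in linarith)
  have N: "?N > 0" "?N' > 0" using n by auto
  have abs: "real (Suc k) * ?N' = real (n - k) * ?N"
    using Suc_times_choose_Suc[of k n] by (metis of_nat_mult)
  \<comment> \<open>T_{k-1} is at most a third of (n choose (k + 1))/100. Two thirds remain; the
    rounding loss of \<open>div\<close> is absorbed by lowering 1/150 to 1/200.\<close>
  have s': "real s \<ge> ?N' / 200"
  proof -
    have arith: "3 * a \<le> b \<Longrightarrow> c \<le> a / 100 \<Longrightarrow> b < 100 * (d + 1) \<Longrightarrow> 1000000 \<le> b \<Longrightarrow> d - c \<le> e \<Longrightarrow> b / 200 \<le> e"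
      for a b c d e :: real by (simp add: field_simps)
    have "3 * (n choose k) \<le> n choose Suc k" using n k by (intro choose_Suc_ge_three_times) auto
    hence "3 * ?N \<le> ?N'" by (metis of_nat_le_iff of_nat_mult of_nat_numeral)
    moreover have "real (sat_time n (k - 1)) \<le> ?N / 100" using sat_time_le[of n "k - 1"] k by simp
    moreover have "n choose Suc k < 100 * (sat_time n k + 1)"
      unfolding sat_time_def using dividend_less_div_times[of 100 "n choose Suc k"]
      by (simp add: algebra_simps)
    hence "?N' < real (100 * (sat_time n k + 1))" by (simp only: of_nat_less_iff)
    hence "?N' < 100 * (real (sat_time n k) + 1)" by simp
    moreover have "n \<le> n choose Suc k" using n k by (intro choose_ge_self) auto
    hence "?N' \<ge> 1000000" using nk by linarith
    moreover have "real s \<ge> real (sat_time n k) - real (sat_time n (k - 1))" unfolding s by linarith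
    ultimately show ?thesis by (rule arith)
  qed
  have fin: "finite I" unfolding I_def
  proof (rule finite_SigmaI)
    fix y assume "y \<in> level n (Suc k)"
    hence "finite (Pow ((\<lambda>i. y - {i}) ` y))" using finite_level_member by blast
    thus "finite {S. S \<subseteq> (\<lambda>i. y - {i}) ` y \<and> Suc k < 20 * card S}" by (rule rev_finite_subset) auto
  qed simp
  have "card I = (\<Sum>y\<in>level n (Suc k). card {S. S \<subseteq> (\<lambda>i. y - {i}) ` y \<and> Suc k < 20 * card S})"
    unfolding I_def
  proof (rule card_SigmaI)
    show "\<forall>y\<in>level n (Suc k). finite {S. S \<subseteq> (\<lambda>i. y - {i}) ` y \<and> Suc k < 20 * card S}"
      using finite_level_member by (auto intro!: finite_subset[of _ "Pow (_ ` _)"])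
  qed simp
  also have "\<dots> \<le> (\<Sum>y\<in>level n (Suc k). 2 ^ Suc k)"
  proof (rule sum_mono)
    fix y assume y: "y \<in> level n (Suc k)"
    have fy: "finite y" using y finite_level_member by blast
    have "card {S. S \<subseteq> (\<lambda>i. y - {i}) ` y \<and> Suc k < 20 * card S} \<le> card (Pow ((\<lambda>i. y - {i}) ` y))"
      using fy by (intro card_mono) auto
    also have "\<dots> = 2 ^ card ((\<lambda>i. y - {i}) ` y)" using fy by (simp add: card_Pow)
    also have "\<dots> \<le> 2 ^ card y" using fy by (intro power_increasing card_image_le) auto
    finally show "card {S. S \<subseteq> (\<lambda>i. y - {i}) ` y \<and> Suc k < 20 * card S} \<le> 2 ^ Suc k"
      using y by (simp add: level_def)
  qed
  also have "\<dots> = (n choose Suc k) * 2 ^ Suc k" by (simp only: sum_constant card_level of_nat_id)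
  finally have "real (card I) \<le> real ((n choose Suc k) * 2 ^ Suc k)" by (rule of_nat_mono)
  hence cI: "real (card I) \<le> ?N' * 2 ^ Suc k" by simp
  have each: "measure_pmf.prob (dla_run n s C) (B S) \<le> exp (- 17 / 80000 * (real n - real k))"
    if yS: "(y, S) \<in> I" for y S
  proof -
    have y: "y \<in> level n (Suc k)" and S: "S \<subseteq> (\<lambda>i. y - {i}) ` y" and cS: "Suc k < 20 * card S"
      using yS by (auto simp: I_def)
    have Sl: "S \<subseteq> level n k"
      using S y finite_level_member[OF y] by (auto simp: level_def)
    define p where "p = 17 / 20 * real (card S) / ?N"
    have "card S \<le> n choose k" using card_mono[OF finite_level Sl] by (simp add: card_level)
    hence "real (card S) \<le> ?N" by simp
    hence p: "p \<le> 1" using N by (simp add: p_def field_simps)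
    have "measure_pmf.prob (dla_run n s C) (B S) \<le> (1 - p) ^ s"
      unfolding B_def p_def by (rule prob_vacant_le) (use n k Sl C in auto)
    also have "\<dots> \<le> exp (- p) ^ s"
      using p exp_ge_add_one_self[of "- p"] by (intro power_mono) auto
    also have "\<dots> = exp (- (real s * p))" by (simp add: exp_of_nat_mult[symmetric])
    also have "\<dots> \<le> exp (- 17 / 80000 * (real n - real k))"
    proof -
      have "17 / 80000 * (real n - real k) = ?N' / 200 * (17 / 20 * (real (Suc k) / 20) / ?N)"
        using abs N n by (simp add: field_simps of_nat_diff)
      also have "\<dots> \<le> real s * p"
        unfolding p_def using s' cS N by (intro mult_mono divide_right_mono mult_left_mono) auto
      finally show ?thesis by simp
    qed
    finally show ?thesis .
  qed
  have "measure_pmf.prob (dla_run n s C) (\<Union>(y, S)\<in>I. B S) \<le> (\<Sum>(y, S)\<in>I. measure_pmf.prob (dla_run n s C) (B S))"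
    using measure_pmf.finite_measure_subadditive_finite[OF fin, of "\<lambda>(y, S). B S" "dla_run n s C"]
    by (auto simp: case_prod_beta)
  also have "\<dots> \<le> (\<Sum>_\<in>I. exp (- 17 / 80000 * (real n - real k)))"
    by (rule sum_mono) (use each in auto)
  also have "\<dots> = real (card I) * exp (- 17 / 80000 * (real n - real k))" by simp
  also have "\<dots> \<le> exp (112 / 1000000 * real n + 11) * exp (- 17 / 80000 * (real n - real k))"
    using cI choose_times_two_power_le[OF n(2), of "Suc k"] by (intro mult_right_mono) auto
  also have "\<dots> \<le> exp (- real n / 20000)"
    unfolding exp_add[symmetric] exp_le_cancel_iff using nk by (simp add: field_simps)
  finally show ?thesis .
qed

lemma sat_time_mono:
  assumes "1000000 * k < n" "0 < k"
  shows "sat_time n (k - 1) \<le> sat_time n k"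
proof -
  have "3 * (n choose k) \<le> n choose Suc k" using assms by (intro choose_Suc_ge_three_times) auto
  thus ?thesis unfolding sat_time_def using assms by (simp add: div_le_mono)
qed

text \<open>Saturation persists, so the hypothesis at T_{k-1} holds throughout the interval up to
  T_k. Failure at T_k means that level \<open>n div 4\<close> was reached, that some blockage is
  large, or that many children of one vertex survived although neither happened; these are the three
  error terms of an induction step.\<close>

lemma prob_unsaturated:
  assumes "1000000 \<le> n" "1000000 * k < n"
  shows "measure_pmf.prob (dla_state n (sat_time n k)) {C. \<not> saturated n (Suc k) C}
    \<le> real k * (3 * exp (- real n / 20000))"
  using assms(2)
proof (induction k)
  case 0
  have "measure_pmf.prob (dla_state n (sat_time n 0)) {C. \<not> saturated n (Suc 0) C} = 0"
    using saturated_1 cluster_dla_state by (fastforce simp: measure_pmf_zero_iff)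
  thus ?case by simp
next
  case (Suc k0)
  define k where "k = Suc k0"
  have k: "0 < k" "k - 1 = k0" "1000000 * k < n" using Suc by (auto simp: k_def)
  define s where "s = sat_time n k - sat_time n (k - 1)"
  let ?p = "dla_state n (sat_time n k)" and ?J = "n div 4"
  define B where "B = (\<lambda>S. {C. S \<inter> C = {} \<and> (\<forall>x\<in>S. low_blockage n ?J x C \<le> 1 / 10) \<and> (\<forall>v\<in>C. card v \<le> ?J)})"
  define I where "I = (SIGMA y:level n (Suc k). {S. S \<subseteq> (\<lambda>i. y - {i}) ` y \<and> Suc k < 20 * card S})"
  let ?A1 = "{C. C \<inter> level n ?J \<noteq> {}}" and ?A3 = "\<Union>(y, S)\<in>I. B S"
  let ?A2 = "\<Union>x\<in>level n k. {C. low_blockage n ?J x C \<ge> 1 / 10}"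
  have pe: "?p = bind_pmf (dla_state n (sat_time n k0)) (dla_run n s)"
    using dla_state_add[of n "sat_time n k0" s] sat_time_mono[OF k(3,1)] k by (simp add: s_def)
  have "measure_pmf.prob ?p {C. \<not> saturated n (Suc k) C} \<le> measure_pmf.prob ?p (?A1 \<union> (?A2 \<union> ?A3))"
  proof (rule measure_pmf.finite_measure_mono_AE)
    show "AE C in ?p. C \<in> {C. \<not> saturated n (Suc k) C} \<longrightarrow> C \<in> ?A1 \<union> (?A2 \<union> ?A3)"
    proof (simp only: AE_measure_pmf_iff, intro ballI impI)
      fix C assume C: "C \<in> set_pmf ?p" "C \<in> {C. \<not> saturated n (Suc k) C}"
      have cl: "cluster n C" using C cluster_dla_state by blast
      obtain y S where yS: "y \<in> level n (Suc k)" "S \<subseteq> (\<lambda>i. y - {i}) ` y" "Suc k < 20 * card S" "S \<inter> C = {}"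
        using C unsaturated_witness by blast
      have Sl: "S \<subseteq> level n k"
        using yS(1,2) finite_level_member[OF yS(1)] by (auto simp: level_def)
      show "C \<in> ?A1 \<union> (?A2 \<union> ?A3)"
      proof (cases "C \<in> ?A1 \<union> ?A2")
        case False
        have "card v \<le> ?J" if "v \<in> C" for v
          using cluster_downward[OF cl that, of ?J] False by force
        moreover have "low_blockage n ?J x C \<le> 1 / 10" if "x \<in> S" for x
          using False Sl that by force
        ultimately have "C \<in> B S" using yS(4) by (auto simp: B_def)
        moreover have "(y, S) \<in> I" using yS by (auto simp: I_def)
        ultimately show ?thesis by blast
      qed auto
    qed
  qed auto
  also have "\<dots> \<le> measure_pmf.prob ?p ?A1 + (measure_pmf.prob ?p ?A2 + measure_pmf.prob ?p ?A3)"
    by (intro order_trans[OF measure_Un_le] add_left_mono measure_Un_le) auto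
  also have "measure_pmf.prob ?p ?A1 \<le> exp (- real n)"
    by (rule prob_high_level_occupied[OF assms(1) k(3)])
  also have "exp (- real n) \<le> exp (- real n / 20000)" by simp
  also have "measure_pmf.prob ?p ?A2 \<le> exp (- real n / 20000)"
    by (rule prob_some_blockage[OF assms(1) k(3)])
  also have "measure_pmf.prob ?p ?A3
    \<le> measure_pmf.prob (dla_state n (sat_time n k0)) {C. \<not> saturated n (Suc k0) C} + exp (- real n / 20000)"
    unfolding pe
  proof (rule prob_bind_le)
    fix C assume C: "C \<in> set_pmf (dla_state n (sat_time n k0))" "C \<notin> {C. \<not> saturated n (Suc k0) C}"
    show "measure_pmf.prob (dla_run n s C) ?A3 \<le> exp (- real n / 20000)"
      unfolding B_def I_def
      by (rule prob_unsaturated_step) (use C assms k cluster_dla_state in \<open>auto simp: s_def k_def\<close>)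
  qed auto
  also have "measure_pmf.prob (dla_state n (sat_time n k0)) {C. \<not> saturated n (Suc k0) C}
      \<le> real k0 * (3 * exp (- real n / 20000))"
    using Suc by simp
  finally show ?case by (simp add: k_def algebra_simps)
qed

section \<open>The final estimate on one level\<close>

text \<open>With y = n/k, the bound (n choose k) >= y^k reduces the claim to 7 + 2 ln n + 20y/9 <= k
  ln y. The factor 512 and the square of n are what the variance term in
  \<open>prob_level_nearly_full\<close> requires.\<close>

lemma choose_ge_exp:
  fixes n k :: nat
  assumes k: "0 < k" "1000000 * k < n" "40 * real n \<le> (real k)\<^sup>2 * ln (real n)"
    and n: "7 \<le> ln (real n)" "20 * ln (real n) \<le> real n" "(ln (real n))\<^sup>2 \<le> real n"
  shows "512 * (real n)\<^sup>2 * exp (20 * real n / (9 * real k)) \<le> real (n choose k)"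
proof -
  define L where "L = ln (real n)"
  define x where "x = real k"
  define y where "y = real n / real k"
  have x: "x > 0" "real n > 0" using k by (auto simp: x_def)
  have y: "y > 0" "y * x = real n" using x by (auto simp: y_def x_def)
  have L: "7 \<le> L" "20 * L \<le> real n" "L\<^sup>2 \<le> real n" "40 * real n \<le> x\<^sup>2 * L"
    using n k by (auto simp: L_def x_def)
  have "1000000 * real k < real n" using k(2) by (metis of_nat_less_iff of_nat_mult of_nat_numeral)
  hence y6: "y \<ge> 1000000" using x by (simp add: y_def x_def field_simps)
  have "exp 10 \<le> (3 :: real) ^ 10" using power_mono[OF exp_le, of 10] by (simp add: exp_of_nat_mult[symmetric])
  hence "exp 10 \<le> y" using y6 by simp
  hence ly: "10 \<le> ln y" using y(1) by (simp add: ln_ge_iff)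
  have "exp 7 \<ge> (5 / 2 :: real) ^ 7"
    using exp_lower_Taylor_quadratic[of 1] power_mono[of "5 / 2" "exp 1 :: real" 7]
    by (simp add: exp_of_nat_mult[symmetric])
  moreover have "512 \<le> (5 / 2 :: real) ^ 7" by (simp add: power_divide)
  ultimately have "ln 512 \<le> ln (exp 7 :: real)" by (subst ln_le_cancel_iff) auto
  hence l512: "ln 512 \<le> (7 :: real)" by simp
  have main: "7 + 2 * L + 20 * y / 9 \<le> x * ln y"
  \<comment> \<open>For k <= n^(3/4), ln y is at least (ln n)/4, and the lower threshold for k
    enters as 40 y <= k ln n; this is the origin of c1 = 40. For larger k, both y and ln n are at
    most k, and ln y >= 10 suffices.\<close>
  proof (cases "x ^ 4 \<le> real n ^ 3")
    case True
    have "ln (x ^ 4) \<le> ln (real n ^ 3)" using True x by simp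
    hence "4 * ln x \<le> 3 * L" using x by (simp add: ln_realpow L_def)
    moreover have "ln y = L - ln x" using x by (simp add: y_def L_def x_def ln_div)
    ultimately have "L / 4 \<le> ln y" by simp
    hence a: "x * (L / 4) \<le> x * ln y" using x by (intro mult_left_mono) auto
    have "40 * (y * x) \<le> (x * L) * x" using L y by (simp add: power2_eq_square mult_ac)
    hence b: "40 * y \<le> x * L" using x by (simp add: mult.commute)
    have "40 * (20 * L) \<le> x\<^sup>2 * L" using L by linarith
    hence "800 * L \<le> x\<^sup>2 * L" by simp
    hence "800 \<le> x\<^sup>2" by (rule mult_right_le_imp_le) (use L in simp)
    hence "24\<^sup>2 \<le> x\<^sup>2" by simp
    hence "24 \<le> x" by (rule power2_le_imp_le) (use x in simp)
    hence "24 * L \<le> x * L" using L by (intro mult_right_mono) auto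
    moreover have "x * (L / 4) = x * L / 4" by simp
    ultimately show ?thesis using a b L by linarith
  next
    case False
    have "real n ^ 2 \<le> real n ^ 3" using L by (intro power_increasing) auto
    hence "(real n)\<^sup>2 \<le> (x\<^sup>2)\<^sup>2" using False by (simp add: power_mult[symmetric])
    hence nx: "real n \<le> x\<^sup>2" by (rule power2_le_imp_le) simp
    hence "y * x \<le> x * x" using y by (simp add: power2_eq_square)
    hence yx: "y \<le> x" using x by simp
    have "L\<^sup>2 \<le> x\<^sup>2" using L nx by linarith
    hence Lx: "L \<le> x" by (rule power2_le_imp_le) (use x in simp)
    have "x * 10 \<le> x * ln y" using ly x by (intro mult_left_mono) auto
    thus ?thesis using yx Lx L by linarith
  qed
  have "512 * (real n)\<^sup>2 * exp (20 * real n / (9 * real k)) = exp (ln 512 + 2 * L + 20 * y / 9)"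
    using x by (simp add: exp_add L_def y_def exp_of_nat_mult[symmetric] power2_eq_square exp_double mult_ac)
  also have "\<dots> \<le> exp (x * ln y)" using main l512 by simp
  also have "\<dots> = y ^ k" using y by (simp add: x_def exp_of_nat_mult)
  also have "\<dots> \<le> real (n choose k)"
    unfolding y_def using k by (intro binomial_ge_n_over_k_pow_k) auto
  finally show ?thesis .
qed

text \<open>The early factor gives 1/50 from 1 - x >= e^(-2x) and T_k/(n choose k) <= n/(100k); the
  decay factor gives 20/19 from 1 + z <= e^z. Their sum 1019/950 is below 10/9.\<close>

lemma decay_factors_ge:
  fixes n k :: nat
  assumes "0 < k" "k < n" "2 \<le> n"
  shows "exp (- (10 * real n) / (9 * real k))
    \<le> (1 - 1 / real (n choose k)) ^ sat_time n k * decay k ^ (n - k)"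
proof -
  let ?N = "real (n choose k)" and ?T = "sat_time n k"
  have nN: "n \<le> n choose k" using assms by (intro choose_ge_self) auto
  hence N: "?N \<ge> 2" using assms by linarith
  have ratio: "real (n choose Suc k) / ?N \<le> real n / real k"
  proof -
    have "real (Suc k) * real (n choose Suc k) = real (n - k) * ?N"
      using Suc_times_choose_Suc[of k n] by (metis of_nat_mult)
    hence "real (n choose Suc k) / ?N = real (n - k) / real (Suc k)"
      using N by (simp add: field_simps del: of_nat_Suc)
    also have "\<dots> \<le> real n / real k" using assms by (intro frac_le) auto
    finally show ?thesis .
  qed
  have one: "exp (- (1 / 50 * (real n / real k))) \<le> (1 - 1 / ?N) ^ ?T"
  proof -
    define x where "x = 1 / ?N"
    have x: "0 \<le> x" "x \<le> 1 / 2" using N frac_le[of 1 1 2 ?N] by (auto simp: x_def)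
    have "x\<^sup>2 \<le> x * (1 / 2)" unfolding power2_eq_square using x by (intro mult_left_mono) auto
    hence "- 2 * x \<le> ln (1 - x)" using ln_one_minus_pos_lower_bound[OF x] by linarith
    hence "exp (- 2 * x) \<le> 1 - x" using x by (subst ln_ge_iff[symmetric]) auto
    hence "exp (- 2 * x) ^ ?T \<le> (1 - x) ^ ?T" by (intro power_mono) auto
    hence "exp (- 2 * (real ?T / ?N)) \<le> (1 - x) ^ ?T" by (simp add: exp_of_nat_mult[symmetric] x_def mult.commute)
    moreover have "real ?T / ?N \<le> real (n choose Suc k) / 100 / ?N"
      using sat_time_le[of n k] N by (intro divide_right_mono) auto
    hence "real ?T / ?N \<le> 1 / 100 * (real n / real k)" using ratio by simp
    hence "exp (- (1 / 50 * (real n / real k))) \<le> exp (- 2 * (real ?T / ?N))" by simp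
    ultimately show ?thesis unfolding x_def by linarith
  qed
  have two: "exp (- (20 / 19 * (real n / real k))) \<le> decay k ^ (n - k)"
  proof -
    let ?z = "20 / (19 * real (Suc k))"
    have z: "1 + ?z > 0" by (intro add_pos_nonneg) auto
    have "1 + ?z \<le> exp ?z" by (rule exp_ge_add_one_self)
    hence "1 / exp ?z \<le> decay k" unfolding decay_def using z by (intro divide_left_mono) auto
    hence "exp (- ?z) \<le> decay k" by (simp add: exp_minus field_simps)
    hence "exp (- ?z) ^ (n - k) \<le> decay k ^ (n - k)" by (intro power_mono) auto
    hence "exp (- (real (n - k) * ?z)) \<le> decay k ^ (n - k)" by (simp add: exp_of_nat_mult[symmetric] del: of_nat_Suc)
    moreover have "real (n - k) / real (Suc k) \<le> real n / real k" using assms by (intro frac_le) auto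
    hence "20 / 19 * (real (n - k) / real (Suc k)) \<le> 20 / 19 * (real n / real k)"
      by (intro mult_left_mono) auto
    hence "real (n - k) * ?z \<le> 20 / 19 * (real n / real k)" by (simp add: mult.commute del: of_nat_Suc)
    ultimately show ?thesis by (meson exp_le_cancel_iff neg_le_iff_le order_trans)
  qed
  have "exp (- (10 * real n) / (9 * real k)) \<le> exp (- (1 / 50 * (real n / real k))) * exp (- (20 / 19 * (real n / real k)))"
    unfolding exp_add[symmetric] exp_le_cancel_iff using assms by (simp add: field_simps)
  also have "\<dots> \<le> (1 - 1 / ?N) ^ ?T * decay k ^ (n - k)"
    using one two order_trans[OF exp_ge_zero one] by (intro mult_mono) auto
  finally show ?thesis .
qed

text \<open>\<open>g\<close> bounds the mean number of vacancies at T_k from below,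
  \<open>g / 2\<close> survives concentration, \<open>h\<close> bounds the resulting potential, and
  half of \<open>h\<close> survives to the end. The two halvings produce the factor 1/4.\<close>

lemma prob_level_nearly_full:
  fixes n k :: nat
  assumes k: "0 < k" "1000000 * k < n" "40 * real n \<le> (real k)\<^sup>2 * ln (real n)"
    and n: "1000000 \<le> n" "7 \<le> ln (real n)" "20 * ln (real n) \<le> real n" "(ln (real n))\<^sup>2 \<le> real n"
  shows "measure_pmf.prob (dla_final n)
      {C. real (card (level n k - C)) \<le> exp (- (10 * real n) / (9 * real k)) / 4 * real (n choose k)}
    \<le> real k * (3 * exp (- real n / 20000)) + 2 * exp (- real n)"
proof -
  let ?N = "real (n choose k)" and ?T = "sat_time n k"
  define M where "M = real ((n choose k) + (n choose Suc k))"
  define g where "g = (1 - 1 / ?N) ^ ?T * ?N"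
  define h where "h = decay k ^ (n - k) * (g / 2)"
  define e where "e = exp (- (10 * real n) / (9 * real k))"
  have kn: "k < n" using k by auto
  have N0: "?N > 0" using kn by simp
  have "n choose k \<ge> 1" using kn by (simp add: Suc_le_eq)
  hence N1: "?N \<ge> 1" by linarith
  hence r: "0 \<le> 1 - 1 / ?N" "1 - 1 / ?N \<le> 1" by (auto simp: divide_le_eq_1_pos[OF N0])
  have dec: "0 \<le> decay k ^ (n - k)" "decay k ^ (n - k) \<le> 1"
    using decay_bounds[of k] by (auto simp: power_le_one)
  have M: "M \<ge> ?N" "M > 0" "real ?T \<le> M"
    using N0 sat_time_le[of n k] unfolding M_def of_nat_add by linarith+
  have g: "0 \<le> g" "g \<le> ?N"
    using r N0 by (auto simp: g_def power_le_one mult_left_le_one_le)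
  have eh: "e / 2 * ?N \<le> h"
  proof -
    have "e \<le> (1 - 1 / ?N) ^ ?T * decay k ^ (n - k)"
      unfolding e_def using k kn n by (intro decay_factors_ge) auto
    from mult_right_mono[OF this, of "?N / 2"] show ?thesis by (simp add: h_def g_def mult_ac)
  qed
  have h: "0 \<le> h" "h \<le> g"
  proof -
    show "0 \<le> h" using dec g by (simp add: h_def)
    have "h \<le> 1 * (g / 2)" unfolding h_def using dec g by (intro mult_right_mono) auto
    thus "h \<le> g" using g by simp
  qed
  \<comment> \<open>From (k + 1) M = (n + 1) (n choose k) follows M <= n (n choose k), and h >= e (n
    choose k)/2. So the right side is at least e^2 (n choose k)/(512 n), where \<open>e\<close> is
    the exponential factor of the claim; \<open>choose_ge_exp\<close> bounds this below by
    n.\<close>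
  have big: "real n \<le> h\<^sup>2 / (128 * M)"
  proof -
    have "real (Suc k) * real (n choose Suc k) = real (n - k) * ?N"
      using Suc_times_choose_Suc[of k n] by (metis of_nat_mult)
    hence "real (Suc k) * M = real (Suc n) * ?N"
      using kn by (simp add: M_def algebra_simps of_nat_diff)
    moreover have "2 * M \<le> real (Suc k) * M" using k M by (intro mult_right_mono) auto
    moreover have "real (Suc n) * ?N \<le> (2 * real n) * ?N" using n N0 by (intro mult_right_mono) auto
    ultimately have Mn: "M \<le> real n * ?N" by linarith
    have "512 * (real n)\<^sup>2 * exp (20 * real n / (9 * real k)) \<le> ?N"
      using k n by (intro choose_ge_exp) auto
    hence "512 * (real n)\<^sup>2 * (exp (20 * real n / (9 * real k)) * e\<^sup>2) \<le> ?N * e\<^sup>2"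
      using mult_right_mono[of "512 * (real n)\<^sup>2 * exp (20 * real n / (9 * real k))" ?N "e\<^sup>2"] by (simp add: mult_ac)
    moreover have "exp (20 * real n / (9 * real k)) * e\<^sup>2 = 1"
      unfolding e_def exp_double[symmetric] exp_add[symmetric] by (simp add: field_simps)
    ultimately have Ne: "512 * (real n)\<^sup>2 \<le> ?N * e\<^sup>2" by simp
    have "real n * (128 * M) \<le> real n * (128 * (real n * ?N))" using Mn by (intro mult_left_mono) auto
    also have "\<dots> = (512 * (real n)\<^sup>2) * (?N / 4)" by (simp add: power2_eq_square)
    also have "\<dots> \<le> (?N * e\<^sup>2) * (?N / 4)" using Ne N0 by (intro mult_right_mono) auto
    also have "\<dots> = (e / 2 * ?N)\<^sup>2" by (simp add: power2_eq_square)
    also have "\<dots> \<le> h\<^sup>2" using eh N0 by (intro power_mono) (auto simp: e_def)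
    finally show ?thesis using M by (simp add: pos_le_divide_eq)
  qed
  have early: "measure_pmf.prob (dla_state n ?T) {C. real (card (level n k - C)) \<le> g / 2} \<le> exp (- real n)"
  proof -
    \<comment> \<open>Minimises \<open>- \<mu> * g / 2 + M * \<mu>\<^sup>2\<close>.\<close>
    define \<mu> where "\<mu> = g / (4 * M)"
    have "measure_pmf.prob (dla_state n ?T) {C. real (card (level n k - C)) \<le> g / 2}
       \<le> exp (- \<mu> * g / 2 + real ?T * \<mu>\<^sup>2)"
      unfolding g_def
      by (rule prob_few_vacant_early) (use k kn g M in \<open>auto simp: \<mu>_def divide_le_eq_1\<close>)
    also have "\<dots> \<le> exp (- \<mu> * g / 2 + M * \<mu>\<^sup>2)" using M by (simp add: mult_right_mono)
    also have "- \<mu> * g / 2 + M * \<mu>\<^sup>2 = - (g\<^sup>2 / (16 * M))"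
      using M by (simp add: \<mu>_def power2_eq_square field_simps)
    also have "real n \<le> g\<^sup>2 / (16 * M)"
    proof -
      have "h\<^sup>2 / (128 * M) \<le> g\<^sup>2 / (16 * M)" using h M by (intro frac_le power_mono) auto
      thus ?thesis using big by linarith
    qed
    hence "exp (- (g\<^sup>2 / (16 * M))) \<le> exp (- real n)" by simp
    finally show ?thesis .
  qed
  have final: "measure_pmf.prob (dla_run n s C) {C'. real (card (level n k - C')) \<le> h / 2} \<le> exp (- real n)"
    if C: "cluster n C" "saturated n (Suc k) C" "g / 2 \<le> real (card (level n k - C))" for s C
  proof -
    \<comment> \<open>Minimises \<open>- \<mu> * h / 2 + 8 * M * \<mu>\<^sup>2\<close>.\<close>
    define \<mu> where "\<mu> = h / (32 * M)"
    have "measure_pmf.prob (dla_run n s C) {C'. real (card (level n k - C')) \<le> h / 2}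
      \<le> exp (- \<mu> * h / 2 + 8 * \<mu>\<^sup>2 * real ((n choose k) + (n choose Suc k)))"
    proof (rule prob_few_vacant_final)
      show "h \<le> decay k ^ (n - k) * real (card (level n k - C))"
        unfolding h_def using C dec by (intro mult_left_mono) auto
      show "\<mu> \<le> 1 / 4" using h g M by (simp add: \<mu>_def field_simps)
    qed (use k kn C h M in \<open>auto simp: \<mu>_def\<close>)
    also have "- \<mu> * h / 2 + 8 * \<mu>\<^sup>2 * real ((n choose k) + (n choose Suc k)) = - (h\<^sup>2 / (128 * M))"
      unfolding M_def[symmetric] using M by (simp add: \<mu>_def power2_eq_square field_simps)
    also have "exp (- (h\<^sup>2 / (128 * M))) \<le> exp (- real n)" using big by simp
    finally show ?thesis .
  qed
  have T2: "?T \<le> 2 ^ n"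
    using binomial_le_pow2[of n "Suc k"] by (simp add: sat_time_def)
  define s where "s = 2 ^ n - ?T"
  have fin: "dla_final n = bind_pmf (dla_state n ?T) (dla_run n s)"
    unfolding dla_final_def using dla_state_add[of n ?T s] T2 by (simp add: s_def)
  let ?A = "{C. real (card (level n k - C)) \<le> h / 2}"
  let ?B = "{C. \<not> saturated n (Suc k) C} \<union> {C. real (card (level n k - C)) \<le> g / 2}"
  have "measure_pmf.prob (dla_final n) {C. real (card (level n k - C)) \<le> e / 4 * ?N} \<le> measure_pmf.prob (dla_final n) ?A"
    by (rule measure_pmf.finite_measure_mono) (use eh in auto)
  also have "\<dots> \<le> measure_pmf.prob (dla_state n ?T) ?B + exp (- real n)"
    unfolding fin
    by (rule prob_bind_le) (use final cluster_dla_state in auto)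
  also have "measure_pmf.prob (dla_state n ?T) ?B \<le> real k * (3 * exp (- real n / 20000)) + exp (- real n)"
    by (intro order_trans[OF measure_Un_le] add_mono prob_unsaturated early) (use n k in auto)
  finally show ?thesis by (simp add: e_def)
qed

section \<open>Union over all levels and the limit\<close>

lemma eventually_log_bounds:
  "\<forall>\<^sub>F n :: nat in sequentially. 1000000 \<le> n \<and> 7 \<le> ln (real n) \<and> 20 * ln (real n) \<le> real n \<and> (ln (real n))\<^sup>2 \<le> real n"
proof (intro eventually_conj)
  show "\<forall>\<^sub>F n :: nat in sequentially. 1000000 \<le> n" by (rule eventually_ge_at_top)
  show "\<forall>\<^sub>F n :: nat in sequentially. 7 \<le> ln (real n)" by real_asymp
  show "\<forall>\<^sub>F n :: nat in sequentially. 20 * ln (real n) \<le> real n" by real_asymp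
  show "\<forall>\<^sub>F n :: nat in sequentially. (ln (real n))\<^sup>2 \<le> real n" by real_asymp
qed

theorem theorem4:
  "\<exists>c1 :: real. c1 > 0 \<and>
     (\<forall>\<epsilon> :: real. 0 < \<epsilon> \<and> \<epsilon> < 1 / 100 \<longrightarrow>
        (\<lambda>n. measure_pmf.prob (dla_final n)
           {C. \<forall>k :: nat. sqrt (c1 * real n / ln (real n)) \<le> real k \<and> real k < \<epsilon> ^ 3 * real n \<longrightarrow>
                 (let \<rho> = max (1 - ((real k + 1) / (exp 1 * real n)) ^ 100)
                                (1 - (1 / (10 * exp 1)) ^ 10)
                  in real (card (level n k - C))
                       \<ge> (1 - \<rho>) * exp (- (10 * real n) / (9 * real k)) / 2 * real (n choose k))})
        \<longlonglongrightarrow> 1)"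
proof (intro exI[of _ "40 :: real"] conjI allI impI)
  fix \<epsilon> :: real assume eps: "0 < \<epsilon> \<and> \<epsilon> < 1 / 100"
  define rho where "rho n k = max (1 - ((real k + 1) / (exp 1 * real n)) ^ 100) (1 - (1 / (10 * exp 1)) ^ 10)"
    for n k :: nat
  define Q where "Q n k C \<longleftrightarrow> real (card (level n k - C)) \<ge> (1 - rho n k) * exp (- (10 * real n) / (9 * real k)) / 2 * real (n choose k)"
    for n k C
  define R where "R n k \<longleftrightarrow> sqrt (40 * real n / ln (real n)) \<le> real k \<and> real k < \<epsilon> ^ 3 * real n" for n k :: nat
  define \<delta> where "\<delta> n = real n * (real n * (3 * exp (- real n / 20000)) + 2 * exp (- real n))" for n :: nat
  define G where "G n = {C. \<forall>k. R n k \<longrightarrow> Q n k C}" for n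
  \<comment> \<open>The second entry of the maximum gives this; it lowers the required number of
    vacancies to the quarter proved by \<open>prob_level_nearly_full\<close>.\<close>
  have rho: "1 - rho n k \<le> 1 / 2" for n k
  proof -
    have "1 \<le> exp (1 :: real)" by simp
    hence "1 / (10 * exp 1) \<le> (1 / 10 :: real)" by (simp add: field_simps)
    hence "(1 / (10 * exp 1)) ^ 10 \<le> (1 / 10 :: real) ^ 10" by (intro power_mono) auto
    moreover have "(1 / 10 :: real) ^ 10 \<le> 1 / 2" by (simp add: power_divide)
    moreover have "1 - (1 / (10 * exp 1)) ^ 10 \<le> rho n k" unfolding rho_def by (rule max.cobounded2)
    ultimately show ?thesis by linarith
  qed
  have lower: "\<forall>\<^sub>F n in sequentially. 1 - \<delta> n \<le> measure_pmf.prob (dla_final n) (G n)"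
    using eventually_log_bounds
  proof eventually_elim
    case (elim n)
    let ?p = "dla_final n"
    have n0: "real n > 0" "real n \<ge> 1" "ln (real n) > 0" using elim by auto
    define bad where "bad k = {C. real (card (level n k - C)) \<le> exp (- (10 * real n) / (9 * real k)) / 4 * real (n choose k)}" for k
    have Rk: "0 < k \<and> k < n \<and> 1000000 * k < n \<and> 40 * real n \<le> (real k)\<^sup>2 * ln (real n)" if "R n k" for k
    proof -
      have s: "sqrt (40 * real n / ln (real n)) \<le> real k" "real k < \<epsilon> ^ 3 * real n" using that by (auto simp: R_def)
      have "0 < sqrt (40 * real n / ln (real n))" using n0 by simp
      hence k0: "0 < real k" using s by linarith
      have "40 * real n / ln (real n) \<le> (real k)\<^sup>2" using s(1) by (rule sqrt_le_D)
      hence a: "40 * real n \<le> (real k)\<^sup>2 * ln (real n)" using n0 by (simp add: pos_divide_le_eq)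
      \<comment> \<open>The cube of 1/100 is the origin of the range k < n/10^6.\<close>
      have "\<epsilon> ^ 3 \<le> (1 / 100) ^ 3" using eps by (intro power_mono) auto
      hence "\<epsilon> ^ 3 * real n \<le> (1 / 100) ^ 3 * real n" by (intro mult_right_mono) auto
      hence "1000000 * real k < real n" using s(2) by (simp add: power_divide)
      hence "real (1000000 * k) < real n" by simp
      hence "1000000 * k < n" by (simp only: of_nat_less_iff)
      thus ?thesis using a k0 by auto
    qed
    have "measure_pmf.prob ?p (- G n) \<le> measure_pmf.prob ?p (\<Union>k\<in>{k. R n k}. bad k)"
    proof (rule measure_pmf.finite_measure_mono)
      show "- G n \<subseteq> (\<Union>k\<in>{k. R n k}. bad k)"
      proof
        fix C assume "C \<in> - G n"
        then obtain k where k: "R n k" "\<not> Q n k C" by (auto simp: G_def)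
        have "(1 - rho n k) * exp (- (10 * real n) / (9 * real k)) / 2 * real (n choose k)
          \<le> 1 / 2 * exp (- (10 * real n) / (9 * real k)) / 2 * real (n choose k)"
          using rho by (intro mult_right_mono divide_right_mono) auto
        also have "\<dots> = exp (- (10 * real n) / (9 * real k)) / 4 * real (n choose k)" by simp
        finally have "C \<in> bad k" using k(2) unfolding Q_def bad_def mem_Collect_eq by linarith
        thus "C \<in> (\<Union>k\<in>{k. R n k}. bad k)" using k by blast
      qed
    qed simp
    also have fin: "finite {k. R n k}" by (rule finite_subset[of _ "{..<n}"]) (use Rk in auto)
    have "measure_pmf.prob ?p (\<Union>k\<in>{k. R n k}. bad k) \<le> (\<Sum>k\<in>{k. R n k}. measure_pmf.prob ?p (bad k))"
      by (rule measure_pmf.finite_measure_subadditive_finite) (use fin in auto)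
    also have "\<dots> \<le> (\<Sum>k\<in>{k. R n k}. real n * (3 * exp (- real n / 20000)) + 2 * exp (- real n))"
    proof (rule sum_mono)
      fix k assume "k \<in> {k. R n k}"
      hence k: "0 < k" "k < n" "1000000 * k < n" "40 * real n \<le> (real k)\<^sup>2 * ln (real n)" using Rk by auto
      have "measure_pmf.prob ?p (bad k) \<le> real k * (3 * exp (- real n / 20000)) + 2 * exp (- real n)"
        unfolding bad_def by (rule prob_level_nearly_full) (use k elim in auto)
      also have "\<dots> \<le> real n * (3 * exp (- real n / 20000)) + 2 * exp (- real n)"
        using k by (intro add_right_mono mult_right_mono) auto
      finally show "measure_pmf.prob ?p (bad k) \<le> real n * (3 * exp (- real n / 20000)) + 2 * exp (- real n)" .
    qed
    also have "\<dots> \<le> \<delta> n"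
    proof -
      have "card {k. R n k} \<le> card {..<n}" by (rule card_mono) (use Rk in auto)
      thus ?thesis by (simp add: \<delta>_def mult_right_mono)
    qed
    finally have "measure_pmf.prob ?p (- G n) \<le> \<delta> n" .
    moreover have "measure_pmf.prob ?p (- G n) = 1 - measure_pmf.prob ?p (G n)"
      using measure_pmf.prob_compl[of "G n" ?p] by (simp add: Compl_eq_Diff_UNIV)
    ultimately show ?case by linarith
  qed
  have "(\<lambda>n. 1 - \<delta> n) \<longlonglongrightarrow> 1" unfolding \<delta>_def by real_asymp
  hence "(\<lambda>n. measure_pmf.prob (dla_final n) (G n)) \<longlonglongrightarrow> 1"
    by (rule tendsto_sandwich[OF lower always_eventually _ tendsto_const, rotated]) simp
  thus "(\<lambda>n. measure_pmf.prob (dla_final n)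
           {C. \<forall>k :: nat. sqrt (40 * real n / ln (real n)) \<le> real k \<and> real k < \<epsilon> ^ 3 * real n \<longrightarrow>
                 (let \<rho> = max (1 - ((real k + 1) / (exp 1 * real n)) ^ 100)
                                (1 - (1 / (10 * exp 1)) ^ 10)
                  in real (card (level n k - C))
                       \<ge> (1 - \<rho>) * exp (- (10 * real n) / (9 * real k)) / 2 * real (n choose k))})
        \<longlonglongrightarrow> 1"
    unfolding G_def R_def Q_def rho_def Let_def .
qed simp

end
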